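(* For every integer $h\geq 2$, the complete binary tree $C^2_h$ of height $h$ has exactly $$N(C^2_h)=\left\lfloor 2\,\kappa^{2^h}\right\rfloor$$ nonisomorphic leaf-induced subtrees, where $\kappa=\kappa(2)$ is the real constant defined by $$\log\kappa=-\log 2+\sum_{j=0}^{\infty}2^{-1-j}\log\left(2\cdot\frac{N(C^2_{j+1})}{N(C^2_j)^2}\right),$$ whose decimal expansion begins $$\kappa=1.2460208329836625089431529441999359284665241772983812581\ldots$$
   Context: A topological tree is a (finite) rooted tree with no vertex of outdegree $1$ (the one-vertex tree is a topological tree). Leaves are the vertices of outdegree $0$. Leaf-induced subtrees: let $T$ be a topological tree and $S$ a nonempty subset of its leaves. The subtree induced by $S$ is obtained as follows: (1) take the most recent common ancestor of the leaves in $S$ and all vertices and edges on the paths connecting it to the leaves in $S$, giving a tree rooted at that common ancestor; (2) contract every vertex of outdegree $1$ in this tree (if $g$ has outdegree $1$ and neighbours $f$ and $h$, delete $g$ and add the edge $\{f,h\}$). The result is again a topological tree; a single leaf induces the one-vertex tree. Isomorphism means isomorphism of rooted trees (root-preserving, children unordered). $N(T)$ denotes the number of isomorphism classes of leaf-induced subtrees of $T$, over all nonempty subsets $S$ of leaves. The complete binary tree $C^2_h$ of height $h$ is the rooted tree in which every vertex has outdegree $0$ or $2$ and all leaves are at distance $h$ from the root; it has $2^h$ leaves, and $C^2_0$ is the one-vertex tree. Here $\log$ is the natural logarithm. *)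

theory Defs
  imports Complex_Main
begin

text \<open>Rooted trees as sets of vertices with edges directed from parent to child. Children carry
  no order.\<close>

record 'a rooted_graph =
  verts :: "'a set"
  edges :: "('a \<times> 'a) set"
  root :: 'a

definition outdeg :: "'a rooted_graph \<Rightarrow> 'a \<Rightarrow> nat" where
  "outdeg T v = card {w. (v, w) \<in> edges T}"

definition rooted_tree :: "'a rooted_graph \<Rightarrow> bool" where
  "rooted_tree T \<longleftrightarrow>
     finite (verts T) \<and> root T \<in> verts T \<and> edges T \<subseteq> verts T \<times> verts T \<and>
     (\<forall>v\<in>verts T. (root T, v) \<in> (edges T)\<^sup>*) \<and>
     (\<forall>u. (u, root T) \<notin> edges T) \<and>
     (\<forall>v\<in>verts T - {root T}. \<exists>!u. (u, v) \<in> edges T)"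

definition topological_tree :: "'a rooted_graph \<Rightarrow> bool" where
  "topological_tree T \<longleftrightarrow> rooted_tree T \<and> (\<forall>v\<in>verts T. outdeg T v \<noteq> 1)"

definition leaves :: "'a rooted_graph \<Rightarrow> 'a set" where
  "leaves T = {v \<in> verts T. outdeg T v = 0}"

definition isomorphic :: "'a rooted_graph \<Rightarrow> 'b rooted_graph \<Rightarrow> bool" where
  "isomorphic T T' \<longleftrightarrow>
     (\<exists>f. bij_betw f (verts T) (verts T') \<and> f (root T) = root T' \<and>
        (\<forall>u\<in>verts T. \<forall>v\<in>verts T. (u, v) \<in> edges T \<longleftrightarrow> (f u, f v) \<in> edges T'))"

definition common_ancestor :: "'a rooted_graph \<Rightarrow> 'a set \<Rightarrow> 'a \<Rightarrow> bool" where
  "common_ancestor T S a \<longleftrightarrow> a \<in> verts T \<and> (\<forall>s\<in>S. (a, s) \<in> (edges T)\<^sup>*)"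

definition mrca :: "'a rooted_graph \<Rightarrow> 'a set \<Rightarrow> 'a" where
  "mrca T S =
     (THE a. common_ancestor T S a \<and> (\<forall>b. common_ancestor T S b \<longrightarrow> (b, a) \<in> (edges T)\<^sup>*))"

definition spanned_subtree :: "'a rooted_graph \<Rightarrow> 'a set \<Rightarrow> 'a rooted_graph" where
  "spanned_subtree T S =
     \<lparr>verts = {v. (mrca T S, v) \<in> (edges T)\<^sup>* \<and> (\<exists>s\<in>S. (v, s) \<in> (edges T)\<^sup>*)},
      edges = {(u, v) \<in> edges T. (mrca T S, u) \<in> (edges T)\<^sup>* \<and> (\<exists>s\<in>S. (v, s) \<in> (edges T)\<^sup>*)},
      root = mrca T S\<rparr>"

text \<open>Contraction of a single vertex \<open>g\<close> of outdegree 1 with parent \<open>f\<close> and child \<open>h\<close>. A root of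
  outdegree 1 is never contracted; this does not matter here, because the most recent common
  ancestor of at least two leaves has outdegree at least 2 in the subtree they span.\<close>

inductive contract_step :: "'a rooted_graph \<Rightarrow> 'a rooted_graph \<Rightarrow> bool" for T where
  "\<lbrakk>outdeg T g = 1; (f, g) \<in> edges T; (g, h) \<in> edges T\<rbrakk> \<Longrightarrow>
   contract_step T
     \<lparr>verts = verts T - {g},
      edges = insert (f, h) {(u, v) \<in> edges T. u \<noteq> g \<and> v \<noteq> g},
      root = root T\<rparr>"

definition induced_subtree :: "'a rooted_graph \<Rightarrow> 'a set \<Rightarrow> 'a rooted_graph \<Rightarrow> bool" where
  "induced_subtree T S T' \<longleftrightarrow>
     contract_step\<^sup>*\<^sup>* (spanned_subtree T S) T' \<and> (\<forall>v\<in>verts T'. outdeg T' v \<noteq> 1)"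

definition leaf_induced_subtrees :: "'a rooted_graph \<Rightarrow> 'a rooted_graph set" where
  "leaf_induced_subtrees T = {T'. \<exists>S. S \<noteq> {} \<and> S \<subseteq> leaves T \<and> induced_subtree T S T'}"

definition num_leaf_induced :: "'a rooted_graph \<Rightarrow> nat" where
  "num_leaf_induced T =
     card (leaf_induced_subtrees T //
       {(T1, T2). T1 \<in> leaf_induced_subtrees T \<and> T2 \<in> leaf_induced_subtrees T \<and>
          isomorphic T1 T2})"

text \<open>A vertex of the complete binary tree is the sequence of turns on the path from the root.\<close>

definition complete_binary_tree :: "nat \<Rightarrow> bool list rooted_graph" where
  "complete_binary_tree h =
     \<lparr>verts = {p. length p \<le> h},
      edges = {(p, p @ [b]) | p b. length p < h},
      root = []\<rparr>"

lemma outdeg_complete_binary_tree: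
  "outdeg (complete_binary_tree h) p = (if length p < h then 2 else 0)"
proof -
  have "{w. (p, w) \<in> edges (complete_binary_tree h)} =
    (if length p < h then {p @ [True], p @ [False]} else {})"
    by (auto simp: complete_binary_tree_def)
  then show ?thesis by (simp add: outdeg_def)
qed

lemma leaves_complete_binary_tree: "leaves (complete_binary_tree h) = {p. length p = h}"
proof -
  have "verts (complete_binary_tree h) = {p. length p \<le> h}"
    by (simp add: complete_binary_tree_def)
  then show ?thesis by (auto simp: leaves_def outdeg_complete_binary_tree split: if_splits)
qed

lemma topological_tree_complete_binary_tree: "topological_tree (complete_binary_tree h)"
proof -
  let ?T = "complete_binary_tree h"
  have "{p :: bool list. length p \<le> h} = {p. set p \<subseteq> UNIV \<and> length p \<le> h}" by simp
  then have fin: "finite {p :: bool list. length p \<le> h}"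
    using finite_lists_length_le[of "UNIV :: bool set" h] by simp
  have reach: "([], p) \<in> (edges ?T)\<^sup>*" if "length p \<le> h" for p
    using that
  proof (induction p rule: rev_induct)
    case (snoc b p)
    then have "(p, p @ [b]) \<in> edges ?T" by (auto simp: complete_binary_tree_def)
    with snoc show ?case by (auto intro: rtrancl_into_rtrancl)
  qed simp
  have par: "\<exists>!u. (u, p) \<in> edges ?T" if "length p \<le> h" "p \<noteq> []" for p
    using that by (cases p rule: rev_cases) (auto simp: complete_binary_tree_def)
  have "rooted_tree ?T"
    unfolding rooted_tree_def using fin reach par
    by (auto simp: complete_binary_tree_def)
  then show ?thesis by (simp add: topological_tree_def outdeg_complete_binary_tree)
qed

definition kappa_term :: "nat \<Rightarrow> real" where
  "kappa_term j =
     2 powr (- 1 - real j) *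
     ln (2 * (real (num_leaf_induced (complete_binary_tree (j + 1))) /
              (real (num_leaf_induced (complete_binary_tree j)))\<^sup>2))"

definition kappa :: real where
  "kappa = exp (- ln 2 + (\<Sum>j. kappa_term j))"

end

(* A leaf set S of the complete binary tree determines its induced subtree uniquely: contraction keeps
   the graph the Hasse diagram of a set of vertices under the prefix order, and the surviving vertices
   are S and its branching points. Splitting S at the root shows that the isomorphism types are exactly
   the unordered full binary trees of height at most h, so N_{h+1} = 1 + N_h (N_h + 1) / 2.
   For y_h = N_h / 2 + 1 / 4 this reads y_{h+1} = y_h^2 + 11 / 16, hence y_h^{1/2^h} increases and
   (y_h + 1 / (2 y_h))^{1/2^h} decreases, both to kappa; these bounds give the floor formula for
   h >= 2, and the decimals at h = 9. *)
theory Submission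
  imports Defs "HOL-Library.Sublist" "HOL-Library.Uprod"
begin

section \<open>Shapes of rooted binary trees\<close>

text \<open>Two features of the definitions stand in the way of counting: the count is a quotient of
  concrete graphs by isomorphism, and contraction is a nondeterministic relation on graphs.
  Isomorphism classes are named by a \<open>shape\<close>; \<open>uprod\<close> builds the missing
  order of children into the datatype, so that being isomorphic becomes plain equality. Contraction
  is tamed through outdegrees: contracting a vertex changes no other outdegree, so the vertices to
  be removed are fixed in advance and the order of steps is irrelevant. On the analytic side the
  series for log kappa telescopes, so kappa is the limit of (N_h / 2)^(1 / 2^h). The shift by 1/4
  serves twice: it makes y_h monotone under squaring, and it places the lower bound 2 y_h for 2
  kappa^(2^h) at N_h + 1/2, so that an error below 1/2 is enough for the floor.\<close>

datatype shape = Leaf | Node "shape uprod"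

text \<open>Carrying the exact vertex and edge sets pins down the whole graph up to renaming, which
  is what turns equal shapes into an isomorphism. The disjointness conditions make the graph a
  tree.\<close>

inductive has_shape :: "'a set \<Rightarrow> ('a \<times> 'a) set \<Rightarrow> 'a \<Rightarrow> shape \<Rightarrow> bool" where
  has_shape_Leaf: "has_shape {r} {} r Leaf"
| has_shape_Node: "\<lbrakk>has_shape V1 E1 r1 s; has_shape V2 E2 r2 t; V1 \<inter> V2 = {}; r \<notin> V1 \<union> V2\<rbrakk> \<Longrightarrow>
    has_shape (insert r (V1 \<union> V2)) (insert (r, r1) (insert (r, r2) (E1 \<union> E2))) r (Node (Upair s t))"

inductive_cases has_shape_LeafE: "has_shape V E r Leaf"
inductive_cases has_shape_NodeE: "has_shape V E r (Node p)"

lemma has_shape_root: "has_shape V E r s \<Longrightarrow> r \<in> V"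
  by (induction rule: has_shape.induct) auto

lemma has_shape_edges: "has_shape V E r s \<Longrightarrow> E \<subseteq> V \<times> V"
  by (induction rule: has_shape.induct) (auto dest: has_shape_root)

lemma has_shape_image:
  "has_shape V E r s \<Longrightarrow> inj_on f V \<Longrightarrow> has_shape (f ` V) (map_prod f f ` E) (f r) s"
proof (induction rule: has_shape.induct)
  case (has_shape_Leaf r)
  show ?case by (simp add: has_shape.has_shape_Leaf)
next
  case (has_shape_Node V1 E1 r1 s V2 E2 r2 t r)
  have "has_shape (f ` V1) (map_prod f f ` E1) (f r1) s" "has_shape (f ` V2) (map_prod f f ` E2) (f r2) t"
    using has_shape_Node by (auto simp: inj_on_Un)
  moreover have "f ` V1 \<inter> f ` V2 = {}" "f r \<notin> f ` V1 \<union> f ` V2"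
    using has_shape_Node.prems has_shape_Node.hyps(3,4) by (auto simp: inj_on_def)
  ultimately show ?case
    using has_shape.has_shape_Node[of "f ` V1" "map_prod f f ` E1" "f r1" s "f ` V2" "map_prod f f ` E2" "f r2" t "f r"]
    by (simp add: image_Un)
qed

text \<open>Disjointness lets the joint bijection be defined by cases, and the inclusions
  \<open>sub\<close> ensure that it agrees with \<open>f\<close> or \<open>g\<close> at both ends of
  every old edge.\<close>

lemma glue_trees:
  assumes f: "inj_on f V1" "f ` V1 = V1'" "f r1 = r1'" "map_prod f f ` E1 = E1'"
    and g: "inj_on g V2" "g ` V2 = V2'" "g r2 = r2'" "map_prod g g ` E2 = E2'"
    and sub: "E1 \<subseteq> V1 \<times> V1" "E2 \<subseteq> V2 \<times> V2" "r1 \<in> V1" "r2 \<in> V2"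
    and disj: "V1 \<inter> V2 = {}" "r \<notin> V1 \<union> V2" "V1' \<inter> V2' = {}" "r' \<notin> V1' \<union> V2'"
  shows "\<exists>k. inj_on k (insert r (V1 \<union> V2)) \<and> k ` insert r (V1 \<union> V2) = insert r' (V1' \<union> V2') \<and> k r = r' \<and>
    map_prod k k ` insert (r, r1) (insert (r, r2) (E1 \<union> E2)) =
      insert (r', r1') (insert (r', r2') (E1' \<union> E2'))"
proof -
  define k where "k = (\<lambda>x. if x = r then r' else if x \<in> V1 then f x else g x)"
  have k1: "k x = f x" if "x \<in> V1" for x using that disj(2) by (auto simp: k_def)
  have k2: "k x = g x" if "x \<in> V2" for x using that disj(1,2) by (auto simp: k_def)
  have kr: "k r = r'" by (simp add: k_def)
  have V: "k ` V1 = V1'" "k ` V2 = V2'"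
    using f(2) g(2) k1 k2 by (auto simp: image_iff)
  have "map_prod k k ` E1 = map_prod f f ` E1" "map_prod k k ` E2 = map_prod g g ` E2"
    using sub(1,2) k1 k2 by (auto intro!: image_cong)
  then have E: "map_prod k k ` E1 = E1'" "map_prod k k ` E2 = E2'" using f(4) g(4) by auto
  have inj: "inj_on k V1" "inj_on k V2"
    using f(1) g(1) k1 k2 by (auto simp: inj_on_def)
  have "inj_on k (V1 \<union> V2)"
    using inj V disj(3) by (auto simp: inj_on_Un)
  moreover have "k r \<notin> k ` (V1 \<union> V2 - {r})" using V disj(4) kr by auto
  ultimately have "inj_on k (insert r (V1 \<union> V2))" by simp
  moreover have "k r1 = r1'" "k r2 = r2'" using sub k1 k2 f(3) g(3) by auto
  ultimately show ?thesis
    by (intro exI[of _ k]) (simp add: kr V E image_Un)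
qed

lemma has_shape_unique_tree:
  "has_shape V E r s \<Longrightarrow> has_shape V' E' r' s \<Longrightarrow>
   \<exists>f. inj_on f V \<and> f ` V = V' \<and> f r = r' \<and> map_prod f f ` E = E'"
proof (induction arbitrary: V' E' r' rule: has_shape.induct)
  case (has_shape_Leaf r)
  then show ?case by (auto elim!: has_shape_LeafE)
next
  case (has_shape_Node V1 E1 r1 s V2 E2 r2 t r)
  note sub = has_shape_edges[OF has_shape_Node.hyps(1)] has_shape_edges[OF has_shape_Node.hyps(2)]
    has_shape_root[OF has_shape_Node.hyps(1)] has_shape_root[OF has_shape_Node.hyps(2)]
  \<comment> \<open>Equality of \<open>Upair\<close> terms also allows a crosswise match. Exchanging
    the two subtrees of the second tree in that case reduces it to the straight one.\<close>
  have "\<exists>V1' E1' r1' V2' E2' r2'. has_shape V1' E1' r1' s \<and> has_shape V2' E2' r2' t \<and>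
    V1' \<inter> V2' = {} \<and> r' \<notin> V1' \<union> V2' \<and> V' = insert r' (V1' \<union> V2') \<and>
    E' = insert (r', r1') (insert (r', r2') (E1' \<union> E2'))"
    using has_shape_Node.prems
  proof cases
    case 1: (has_shape_Node W1 F1 q1 s' W2 F2 q2 t')
    then consider "s = s'" "t = t'" | "s = t'" "t = s'" by auto
    then show ?thesis
    proof cases
      case A: 1
      show ?thesis using 1 unfolding A by blast
    next
      case A: 2
      have "V' = insert r' (W2 \<union> W1)" "E' = insert (r', q2) (insert (r', q1) (F2 \<union> F1))"
        using 1 by auto
      then show ?thesis using 1 unfolding A by blast
    qed
  qed
  then obtain V1' E1' r1' V2' E2' r2' where
    *: "has_shape V1' E1' r1' s" "has_shape V2' E2' r2' t"
      "V1' \<inter> V2' = {}" "r' \<notin> V1' \<union> V2'" "V' = insert r' (V1' \<union> V2')"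
      "E' = insert (r', r1') (insert (r', r2') (E1' \<union> E2'))" by blast
  obtain f where f: "inj_on f V1" "f ` V1 = V1'" "f r1 = r1'" "map_prod f f ` E1 = E1'"
    using has_shape_Node.IH(1)[OF *(1)] by blast
  obtain g where g: "inj_on g V2" "g ` V2 = V2'" "g r2 = r2'" "map_prod g g ` E2 = E2'"
    using has_shape_Node.IH(2)[OF *(2)] by blast
  show ?case
    unfolding *(5,6)
    using glue_trees[OF f g sub has_shape_Node.hyps(3,4) *(3,4)] .
qed

text \<open>Unlike \<^const>\<open>has_shape\<close>, the following predicate only looks at children, so it is visibly
  determined by the graph and transported by isomorphisms.\<close>

inductive shape_at :: "('a \<times> 'a) set \<Rightarrow> 'a \<Rightarrow> shape \<Rightarrow> bool" for E where
  shape_at_Leaf: "E `` {v} = {} \<Longrightarrow> shape_at E v Leaf"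
| shape_at_Node: "\<lbrakk>E `` {v} = {a, b}; a \<noteq> b; shape_at E a s; shape_at E b t\<rbrakk> \<Longrightarrow>
    shape_at E v (Node (Upair s t))"

lemma shape_at_deterministic: "shape_at E v s \<Longrightarrow> shape_at E v s' \<Longrightarrow> s = s'"
proof (induction arbitrary: s' rule: shape_at.induct)
  case (shape_at_Leaf v)
  from shape_at_Leaf(2,1) show ?case by cases auto
next
  case (shape_at_Node v a b s t)
  from shape_at_Node.prems show ?case
  proof cases
    case shape_at_Leaf
    then show ?thesis using shape_at_Node.hyps(1) by simp
  next
    case 2: (shape_at_Node c d s1 t1)
    have "{a, b} = {c, d}" using 2 shape_at_Node.hyps(1) by simp
    then consider "a = c" "b = d" | "a = d" "b = c" by (auto simp: doubleton_eq_iff)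
    then show ?thesis using shape_at_Node.IH 2 by cases auto
  qed
qed

text \<open>The recursion follows outgoing edges only, so extra edges that start outside
  \<open>V\<close> are invisible from within \<open>V\<close>. Hence a subtree keeps its shape
  inside a joined tree.\<close>

lemma shape_at_closed_subset:
  "shape_at E v s \<Longrightarrow> v \<in> V \<Longrightarrow> E \<subseteq> F \<Longrightarrow> (\<And>u w. (u, w) \<in> F \<Longrightarrow> u \<in> V \<Longrightarrow> (u, w) \<in> E) \<Longrightarrow>
   E \<subseteq> V \<times> V \<Longrightarrow> shape_at F v s"
proof (induction rule: shape_at.induct)
  case (shape_at_Leaf v)
  then show ?case by (intro shape_at.shape_at_Leaf) blast
next
  case (shape_at_Node v a b s t)
  have "F `` {v} = {a, b}" using shape_at_Node.hyps(1) shape_at_Node.prems by blast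
  moreover have "a \<in> V" "b \<in> V" using shape_at_Node.hyps(1) shape_at_Node.prems by blast+
  ultimately show ?case
    using shape_at_Node.IH shape_at_Node.hyps(2) shape_at_Node.prems by (intro shape_at.shape_at_Node) auto
qed

lemma has_shape_imp_shape_at: "has_shape V E r s \<Longrightarrow> shape_at E r s"
proof (induction rule: has_shape.induct)
  case (has_shape_Leaf r)
  show ?case by (rule shape_at_Leaf) simp
next
  case (has_shape_Node V1 E1 r1 s V2 E2 r2 t r)
  let ?F = "insert (r, r1) (insert (r, r2) (E1 \<union> E2))"
  note sub = has_shape_edges[OF has_shape_Node.hyps(1)] has_shape_edges[OF has_shape_Node.hyps(2)]
    has_shape_root[OF has_shape_Node.hyps(1)] has_shape_root[OF has_shape_Node.hyps(2)]
  have "shape_at ?F r1 s"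
  proof (rule shape_at_closed_subset[OF has_shape_Node.IH(1) sub(3) _ _ sub(1)])
    show "E1 \<subseteq> ?F" by blast
    show "(u, w) \<in> E1" if "(u, w) \<in> ?F" "u \<in> V1" for u w
      using that sub has_shape_Node.hyps(3,4) by blast
  qed
  moreover have "shape_at ?F r2 t"
  proof (rule shape_at_closed_subset[OF has_shape_Node.IH(2) sub(4) _ _ sub(2)])
    show "E2 \<subseteq> ?F" by blast
    show "(u, w) \<in> E2" if "(u, w) \<in> ?F" "u \<in> V2" for u w
      using that sub has_shape_Node.hyps(3,4) by blast
  qed
  moreover have "?F `` {r} = {r1, r2}" "r1 \<noteq> r2"
    using sub has_shape_Node.hyps(3,4) by auto
  ultimately show ?case by (intro shape_at_Node)
qed

lemma shape_at_transport:
  assumes "bij_betw f V V'" "E \<subseteq> V \<times> V" "E' \<subseteq> V' \<times> V'"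
    and "\<forall>u\<in>V. \<forall>v\<in>V. (u, v) \<in> E \<longleftrightarrow> (f u, f v) \<in> E'"
  shows "shape_at E v s \<Longrightarrow> v \<in> V \<Longrightarrow> shape_at E' (f v) s"
proof (induction rule: shape_at.induct)
  have ch: "E' `` {f v} = f ` (E `` {v})" if "v \<in> V" for v
  proof -
    have "f ` V = V'" using assms(1) by (simp add: bij_betw_def)
    then show ?thesis using assms(2-4) that by blast
  qed
  {
    case (shape_at_Leaf v)
    then show ?case by (intro shape_at.shape_at_Leaf) (simp add: ch)
  next
    case (shape_at_Node v a b s t)
    have "a \<in> V" "b \<in> V" using shape_at_Node.hyps(1) assms(2) by blast+
    moreover have "f a \<noteq> f b"
      using \<open>a \<in> V\<close> \<open>b \<in> V\<close> shape_at_Node.hyps(2) assms(1) by (auto simp: bij_betw_def inj_on_def)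
    moreover have "E' `` {f v} = {f a, f b}"
      using ch[OF shape_at_Node.prems] shape_at_Node.hyps(1) by simp
    ultimately show ?case using shape_at_Node.IH by (intro shape_at.shape_at_Node) auto
  }
qed

text \<open>Each direction rests on one of the two predicates: an isomorphism carries
  \<open>shape_at\<close> over, where determinism applies, and uniqueness of the tree in
  \<open>has_shape\<close> supplies the bijection.\<close>

lemma isomorphic_iff_same_shape:
  assumes "has_shape (verts T) (edges T) (root T) s" "has_shape (verts T') (edges T') (root T') s'"
  shows "isomorphic T T' \<longleftrightarrow> s = s'"
proof
  assume "isomorphic T T'"
  then obtain f where f: "bij_betw f (verts T) (verts T')" "f (root T) = root T'"
    "\<forall>u\<in>verts T. \<forall>v\<in>verts T. (u, v) \<in> edges T \<longleftrightarrow> (f u, f v) \<in> edges T'"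
    by (auto simp: isomorphic_def)
  have "shape_at (edges T') (root T') s"
    using shape_at_transport[OF f(1) has_shape_edges[OF assms(1)] has_shape_edges[OF assms(2)] f(3)
        has_shape_imp_shape_at[OF assms(1)] has_shape_root[OF assms(1)]] f(2) by simp
  then show "s = s'" using has_shape_imp_shape_at[OF assms(2)] by (rule shape_at_deterministic)
next
  assume "s = s'"
  with assms obtain f where f: "inj_on f (verts T)" "f ` verts T = verts T'" "f (root T) = root T'"
    "map_prod f f ` edges T = edges T'"
    using has_shape_unique_tree[of "verts T" "edges T" "root T" s "verts T'" "edges T'" "root T'"] by blast
  have "(u, v) \<in> edges T \<longleftrightarrow> (f u, f v) \<in> edges T'" if "u \<in> verts T" "v \<in> verts T" for u v
  proof
    assume "(f u, f v) \<in> edges T'"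
    then obtain a b where ab: "(a, b) \<in> edges T" "f u = f a" "f v = f b"
      using f(4) by (force simp: map_prod_def)
    then show "(u, v) \<in> edges T"
      using has_shape_edges[OF assms(1)] that f(1) by (metis inj_onD mem_Sigma_iff subsetD)
  qed (use f(4) in force)
  then show "isomorphic T T'" using f by (auto simp: isomorphic_def bij_betw_def)
qed

section \<open>Contraction in Hasse diagrams of the prefix order\<close>

text \<open>The proper prefixes of a list form a chain, so \<open>v\<close> covers at most one element: the longest proper
  prefix of \<open>v\<close> in \<open>V\<close>. Deleting an element with a unique cover is exactly a contraction step.\<close>

definition cover :: "'a list set \<Rightarrow> ('a list \<times> 'a list) set" where
  "cover V = {(u, v). u \<in> V \<and> v \<in> V \<and> strict_prefix u v \<and> (\<forall>w\<in>V. strict_prefix w v \<longrightarrow> prefix w u)}"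

definition hasse :: "'a list set \<Rightarrow> 'a list \<Rightarrow> 'a list rooted_graph" where
  "hasse V r = \<lparr>verts = V, edges = cover V, root = r\<rparr>"

lemma verts_hasse [simp]: "verts (hasse V r) = V"
  and edges_hasse [simp]: "edges (hasse V r) = cover V"
  and root_hasse [simp]: "root (hasse V r) = r"
  by (simp_all add: hasse_def)

lemma cover_parent_unique: "(u, v) \<in> cover V \<Longrightarrow> (u', v) \<in> cover V \<Longrightarrow> u = u'"
  by (auto simp: cover_def intro: prefix_order.antisym)

lemma cover_Diff:
  assumes fg: "(f, g) \<in> cover V" and ch: "cover V `` {g} = {h}"
  shows "cover (V - {g}) = insert (f, h) {(u, v) \<in> cover V. u \<noteq> g \<and> v \<noteq> g}"
proof -
  have gh: "(g, h) \<in> cover V" using ch by auto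
  have fgh: "strict_prefix f g" "strict_prefix g h" "f \<in> V" "g \<in> V" "h \<in> V"
    using fg gh by (auto simp: cover_def)
  have fne: "f \<noteq> g" "h \<noteq> g" using fgh by auto
  show ?thesis
  proof (intro equalityI subsetI)
    fix e assume e: "e \<in> cover (V - {g})"
    obtain u v where [simp]: "e = (u, v)" by (cases e)
    have uv: "u \<in> V" "u \<noteq> g" "v \<in> V" "v \<noteq> g" "strict_prefix u v"
      and max: "\<And>w. w \<in> V \<Longrightarrow> w \<noteq> g \<Longrightarrow> strict_prefix w v \<Longrightarrow> prefix w u"
      using e by (auto simp: cover_def)
    show "e \<in> insert (f, h) {(u, v) \<in> cover V. u \<noteq> g \<and> v \<noteq> g}"
    \<comment> \<open>A cover of the smaller set can fail to be one in \<open>V\<close> only if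
      \<open>g\<close> lies strictly between \<open>u\<close> and \<open>v\<close>. Then
      \<open>v\<close> covers \<open>g\<close>, so \<open>v = h\<close>, and \<open>u\<close> must
      be the parent \<open>f\<close> of \<open>g\<close>.\<close>
    proof (cases "strict_prefix g v \<and> \<not> prefix g u")
      case False
      then have "(u, v) \<in> cover V" using uv max by (auto simp: cover_def)
      then show ?thesis using uv by simp
    next
      case True
      then have "prefix u g" using uv(5)
        by (metis prefix_order.less_le prefix_same_cases)
      then have ug: "strict_prefix u g" using uv(2) by (simp add: prefix_order.less_le)
      have "prefix w g" if "w \<in> V" "strict_prefix w v" for w
        using max[OF that(1) _ that(2)] \<open>prefix u g\<close> by (cases "w = g") auto
      then have "(g, v) \<in> cover V" using True uv fgh by (auto simp: cover_def)
      then have "v = h" using ch by auto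
      moreover have "prefix u f" using fg uv(1) ug by (auto simp: cover_def)
      moreover have "prefix f u" using max[OF fgh(3) fne(1)] fgh \<open>v = h\<close> by auto
      ultimately show ?thesis by (auto intro: prefix_order.antisym)
    qed
  next
    fix e assume "e \<in> insert (f, h) {(u, v) \<in> cover V. u \<noteq> g \<and> v \<noteq> g}"
    then consider "e = (f, h)" | u v where "e = (u, v)" "(u, v) \<in> cover V" "u \<noteq> g" "v \<noteq> g" by auto
    then show "e \<in> cover (V - {g})"
    proof cases
      case 1
      have "prefix w f" if "w \<in> V" "w \<noteq> g" "strict_prefix w h" for w
      proof -
        have "prefix w g" using gh that by (auto simp: cover_def)
        then show ?thesis using fg that by (auto simp: cover_def prefix_order.less_le)
      qed
      moreover have "strict_prefix f h" using fgh by (meson prefix_order.less_trans)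
      ultimately show ?thesis using 1 fgh fne by (auto simp: cover_def)
    next
      case 2
      then show ?thesis by (auto simp: cover_def)
    qed
  qed
qed

text \<open>The parent of \<open>g\<close> loses the child \<open>g\<close> and gains
  \<open>h\<close>, which it did not have before because \<open>g\<close> is the only parent of
  \<open>h\<close>. All other vertices keep their children.\<close>

lemma outdeg_hasse_Diff:
  assumes fg: "(f, g) \<in> cover V" and ch: "cover V `` {g} = {h}" and "finite V" and "v \<noteq> g"
  shows "outdeg (hasse (V - {g}) r) v = outdeg (hasse V r) v"
proof -
  have gh: "(g, h) \<in> cover V" using ch by auto
  have ne: "f \<noteq> g" "h \<noteq> g" using fg gh by (auto simp: cover_def)
  have fh: "(f, h) \<notin> cover V" using cover_parent_unique[OF gh, of f] ne by auto
  show ?thesis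
  proof (cases "v = f")
    case True
    have "{w. (v, w) \<in> cover (V - {g})} = insert h ({w. (f, w) \<in> cover V} - {g})"
      using True ne by (auto simp: cover_Diff[OF fg ch])
    moreover have "finite {w. (f, w) \<in> cover V}"
      by (rule finite_subset[OF _ \<open>finite V\<close>]) (auto simp: cover_def)
    ultimately show ?thesis
      using card_Suc_Diff1[of "{w. (f, w) \<in> cover V}" g] fg fh True by (simp add: outdeg_def)
  next
    case False
    then have "(v, g) \<notin> cover V" using cover_parent_unique[OF fg] by blast
    then have "{w. (v, w) \<in> cover (V - {g})} = {w. (v, w) \<in> cover V}"
      using False assms(4) by (auto simp: cover_Diff[OF fg ch])
    then show ?thesis by (simp add: outdeg_def)
  qed
qed

lemma contract_step_hasse_cases:
  assumes "contract_step (hasse V r) T'"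
  obtains f g h where "(f, g) \<in> cover V" "cover V `` {g} = {h}" "T' = hasse (V - {g}) r"
  using assms
proof cases
  case (1 g f h)
  have "card (cover V `` {g}) = 1" using 1(2) by (simp add: outdeg_def Image_singleton)
  then obtain h' where h': "cover V `` {g} = {h'}" by (rule card_1_singletonE)
  moreover have "h \<in> cover V `` {g}" using 1(4) by simp
  ultimately have ch: "cover V `` {g} = {h}" by simp
  moreover have "T' = hasse (V - {g}) r"
    using 1 cover_Diff[OF _ ch] by (simp add: hasse_def)
  ultimately show thesis using that 1(3) by simp
qed

lemma contract_step_hasse:
  assumes "(f, g) \<in> cover V" "outdeg (hasse V r) g = 1"
  shows "contract_step (hasse V r) (hasse (V - {g}) r)"
proof -
  obtain h where h: "cover V `` {g} = {h}"
    using assms(2) by (auto simp: outdeg_def Image_singleton card_1_singleton_iff)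
  then have "(g, h) \<in> cover V" by auto
  then show ?thesis
    using contract_step.intros[of "hasse V r" g f h] assms cover_Diff[OF assms(1) h]
    by (simp add: hasse_def)
qed

text \<open>The invariant behind confluence: outdegrees of survivors are the original ones and only
  vertices of original outdegree 1 disappear, so a fully contracted graph must consist of exactly
  the vertices of original outdegree other than 1.\<close>

lemma contract_steps_hasse:
  assumes "contract_step\<^sup>*\<^sup>* (hasse V r) T'" "finite V"
  shows "\<exists>W\<subseteq>V. T' = hasse W r \<and> (\<forall>v\<in>W. outdeg T' v = outdeg (hasse V r) v) \<and>
    (\<forall>v\<in>V - W. outdeg (hasse V r) v = 1)"
  using assms(1)
proof induction
  case base
  show ?case by blast
next
  case (step T' T'')
  then obtain W where W: "W \<subseteq> V" "T' = hasse W r" "\<forall>v\<in>W. outdeg T' v = outdeg (hasse V r) v"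
    "\<forall>v\<in>V - W. outdeg (hasse V r) v = 1" by blast
  from step.hyps(2)[unfolded W(2)] obtain f g h where
    *: "(f, g) \<in> cover W" "cover W `` {g} = {h}" "T'' = hasse (W - {g}) r"
    by (rule contract_step_hasse_cases)
  have "finite W" using W(1) assms(2) finite_subset by blast
  have g: "outdeg (hasse V r) g = 1"
    using W(2,3) *(1,2) by (auto simp: outdeg_def cover_def Image_singleton)
  show ?case
    using W g *(3) outdeg_hasse_Diff[OF *(1,2) \<open>finite W\<close>, of _ r]
    by (intro exI[of _ "W - {g}"]) auto
qed

lemma cover_parent_exists:
  assumes "finite V" "r \<in> V" "\<forall>v\<in>V. prefix r v" "v \<in> V" "v \<noteq> r"
  shows "\<exists>u. (u, v) \<in> cover V"
proof -
  let ?P = "{u \<in> V. strict_prefix u v}"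
  have "finite ?P" "r \<in> ?P" using assms by (auto simp: prefix_order.less_le)
  then have "Max (length ` ?P) \<in> length ` ?P" by (intro Max_in) auto
  then obtain u where u: "u \<in> ?P" "length u = Max (length ` ?P)" by auto
  then have max: "length w \<le> length u" if "w \<in> ?P" for w
    using that \<open>finite ?P\<close> by simp
  have "prefix w u" if "w \<in> ?P" for w
    using u(1) max[OF that] that by (auto intro: prefix_length_prefix[of w v u])
  then have "(u, v) \<in> cover V" using u(1) assms(4) by (auto simp: cover_def)
  then show ?thesis ..
qed

text \<open>Each step shrinks the finite set \<open>V\<close>, so contraction terminates. The root
  has no parent and cannot be contracted; its outdegree differs from 1 initially and no step changes
  it.\<close>

lemma contract_hasse_exists:
  assumes "finite V" "r \<in> V" "\<forall>v\<in>V. prefix r v" "outdeg (hasse V r) r \<noteq> 1"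
  shows "\<exists>T'. contract_step\<^sup>*\<^sup>* (hasse V r) T' \<and> (\<forall>v\<in>verts T'. outdeg T' v \<noteq> 1)"
  using assms
proof (induction "card V" arbitrary: V rule: less_induct)
  case less
  show ?case
  proof (cases "\<exists>g\<in>V. outdeg (hasse V r) g = 1")
    case True
    then obtain g where g: "g \<in> V" "outdeg (hasse V r) g = 1" by blast
    then have "g \<noteq> r" using less.prems by auto
    then obtain f where f: "(f, g) \<in> cover V" using cover_parent_exists less.prems g by blast
    obtain h where h: "cover V `` {g} = {h}"
      using g(2) by (auto simp: outdeg_def Image_singleton card_1_singleton_iff)
    have "outdeg (hasse (V - {g}) r) r \<noteq> 1"
      using outdeg_hasse_Diff[OF f h less.prems(1), of r r] \<open>g \<noteq> r\<close> less.prems(4) by auto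
    moreover have "card (V - {g}) < card V" using g less.prems(1) by (meson card_Diff1_less)
    ultimately obtain T' where "contract_step\<^sup>*\<^sup>* (hasse (V - {g}) r) T'" "\<forall>v\<in>verts T'. outdeg T' v \<noteq> 1"
      using less.hyps[of "V - {g}"] less.prems \<open>g \<noteq> r\<close> by auto
    then show ?thesis using contract_step_hasse[OF f g(2)]
      by (meson converse_rtranclp_into_rtranclp)
  next
    case False
    then show ?thesis by (intro exI[of _ "hasse V r"]) auto
  qed
qed

section \<open>Leaf-induced subtrees of complete binary trees\<close>

text \<open>The disjunct \<open>u = v\<close> covers lists longer than \<open>h\<close>: they are
  not vertices, but the reflexive closure relates them to themselves.\<close>

lemma rtrancl_edges_complete_binary_tree:
  "(u, v) \<in> (edges (complete_binary_tree h))\<^sup>* \<longleftrightarrow> u = v \<or> prefix u v \<and> length v \<le> h"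
proof
  assume "(u, v) \<in> (edges (complete_binary_tree h))\<^sup>*"
  then show "u = v \<or> prefix u v \<and> length v \<le> h"
    by induction (auto simp: complete_binary_tree_def)
next
  have "(u, u @ w) \<in> (edges (complete_binary_tree h))\<^sup>*" if "length (u @ w) \<le> h" for w
    using that
  proof (induction w rule: rev_induct)
    case (snoc b w)
    then have "(u @ w, u @ w @ [b]) \<in> edges (complete_binary_tree h)"
      by (auto simp: complete_binary_tree_def)
    with snoc show ?case by (auto intro: rtrancl_into_rtrancl)
  qed simp
  then show "u = v \<or> prefix u v \<and> length v \<le> h \<Longrightarrow> (u, v) \<in> (edges (complete_binary_tree h))\<^sup>*"
    by (auto simp: prefix_def)
qed

text \<open>Ancestry is the prefix order, so a most recent common ancestor is a greatest common
  prefix, and antisymmetry makes the \<open>THE\<close> well defined.\<close>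

lemma mrca_complete_binary_tree:
  assumes "S \<noteq> {}" "\<forall>s\<in>S. length s = h"
  shows "mrca (complete_binary_tree h) S = Longest_common_prefix S"
proof -
  have ca: "common_ancestor (complete_binary_tree h) S a \<longleftrightarrow> (\<forall>s\<in>S. prefix a s)" for a
  proof -
    have "length a \<le> h" if "\<forall>s\<in>S. prefix a s"
      using that assms by (metis ex_in_conv prefix_length_le)
    then show ?thesis
      using assms(2) by (auto simp: common_ancestor_def rtrancl_edges_complete_binary_tree)
        (auto simp: complete_binary_tree_def)
  qed
  have le: "length a \<le> h" if "\<forall>s\<in>S. prefix a s" for a
    using that assms by (metis ex_in_conv prefix_length_le)
  show ?thesis
    unfolding mrca_def ca
  proof (rule the_equality)
    show "(\<forall>s\<in>S. prefix (Longest_common_prefix S) s) \<and> (\<forall>b. (\<forall>s\<in>S. prefix b s) \<longrightarrow>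
      (b, Longest_common_prefix S) \<in> (edges (complete_binary_tree h))\<^sup>*)"
      using assms(1) le
      by (auto simp: rtrancl_edges_complete_binary_tree Longest_common_prefix_prefix
          intro: Longest_common_prefix_max_prefix)
    show "a = Longest_common_prefix S" if "(\<forall>s\<in>S. prefix a s) \<and> (\<forall>b. (\<forall>s\<in>S. prefix b s) \<longrightarrow>
      (b, a) \<in> (edges (complete_binary_tree h))\<^sup>*)" for a
    proof (rule prefix_order.antisym)
      show "prefix a (Longest_common_prefix S)"
        using that assms(1) by (intro Longest_common_prefix_max_prefix) auto
      show "prefix (Longest_common_prefix S) a"
        using that by (auto simp: rtrancl_edges_complete_binary_tree Longest_common_prefix_prefix
            dest!: spec[of _ "Longest_common_prefix S"])
    qed
  qed
qed

definition spanned_verts :: "'a list set \<Rightarrow> 'a list set" where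
  "spanned_verts S = {v. prefix (Longest_common_prefix S) v \<and> (\<exists>s\<in>S. prefix v s)}"

text \<open>The spanned vertices are convex in the prefix order: the next list on the way from
  \<open>u\<close> to \<open>v\<close> is spanned too, so nothing longer than one turn is a cover.
  This matches tree edges with Hasse edges before any contraction.\<close>

lemma cover_spanned_verts: "cover (spanned_verts S) = {(u, u @ [b]) | u b. u \<in> spanned_verts S \<and> u @ [b] \<in> spanned_verts S}"
proof (intro equalityI subsetI)
  fix e assume e: "e \<in> cover (spanned_verts S)"
  obtain u v where [simp]: "e = (u, v)" by (cases e)
  have uv: "u \<in> spanned_verts S" "v \<in> spanned_verts S" "strict_prefix u v"
    and max: "\<And>w. w \<in> spanned_verts S \<Longrightarrow> strict_prefix w v \<Longrightarrow> prefix w u"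
    using e by (auto simp: cover_def)
  obtain b z where z: "v = u @ b # z" using uv(3) by (rule strict_prefixE')
  have "z = []"
  proof (rule ccontr)
    assume "z \<noteq> []"
    have "u @ [b] \<in> spanned_verts S"
    proof -
      obtain s where "s \<in> S" "prefix v s" using uv(2) by (auto simp: spanned_verts_def)
      moreover have "prefix (u @ [b]) v" using z by simp
      ultimately show ?thesis using uv(1) by (auto simp: spanned_verts_def intro: prefix_order.trans)
    qed
    moreover have "strict_prefix (u @ [b]) v" using \<open>z \<noteq> []\<close> z by (simp add: strict_prefix_def)
    ultimately have "prefix (u @ [b]) u" by (rule max)
    then show False by (simp add: prefix_def)
  qed
  then show "e \<in> {(u, u @ [b]) | u b. u \<in> spanned_verts S \<and> u @ [b] \<in> spanned_verts S}" using uv z by simp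
next
  fix e assume "e \<in> {(u, u @ [b]) | u b. u \<in> spanned_verts S \<and> u @ [b] \<in> spanned_verts S}"
  then obtain u b where "e = (u, u @ [b])" "u \<in> spanned_verts S" "u @ [b] \<in> spanned_verts S" by blast
  then show "e \<in> cover (spanned_verts S)" by (auto simp: cover_def strict_prefix_def)
qed

lemma spanned_verts_append_iff: "u \<in> spanned_verts S \<Longrightarrow> u @ [b] \<in> spanned_verts S \<longleftrightarrow> (\<exists>s\<in>S. prefix (u @ [b]) s)"
  by (simp add: spanned_verts_def)

lemma spanned_subtree_complete_binary_tree:
  assumes "S \<noteq> {}" "\<forall>s\<in>S. length s = h"
  shows "spanned_subtree (complete_binary_tree h) S = hasse (spanned_verts S) (Longest_common_prefix S)"
proof -
  let ?T = "complete_binary_tree h" and ?l = "Longest_common_prefix S"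
  obtain s0 where "s0 \<in> S" using assms(1) by blast
  then have "length ?l \<le> h"
    using assms(2) Longest_common_prefix_prefix[of s0 S] prefix_length_le by force
  then have V: "(?l, v) \<in> (edges ?T)\<^sup>* \<and> (\<exists>s\<in>S. (v, s) \<in> (edges ?T)\<^sup>*) \<longleftrightarrow> v \<in> spanned_verts S" for v
  proof -
    have "length v \<le> h" if "s \<in> S" "prefix v s" for s
      using that assms(2) prefix_length_le by force
    then show ?thesis
      using assms(2) by (auto simp: spanned_verts_def rtrancl_edges_complete_binary_tree)
  qed
  have "e \<in> {(u, v) \<in> edges ?T. (?l, u) \<in> (edges ?T)\<^sup>* \<and> (\<exists>s\<in>S. (v, s) \<in> (edges ?T)\<^sup>*)} \<longleftrightarrow>
    e \<in> cover (spanned_verts S)" for e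
  proof -
    obtain u v where [simp]: "e = (u, v)" by (cases e)
    show ?thesis
    proof
      assume "e \<in> {(u, v) \<in> edges ?T. (?l, u) \<in> (edges ?T)\<^sup>* \<and> (\<exists>s\<in>S. (v, s) \<in> (edges ?T)\<^sup>*)}"
      then have *: "(u, v) \<in> edges ?T" "(?l, u) \<in> (edges ?T)\<^sup>*" "\<exists>s\<in>S. (v, s) \<in> (edges ?T)\<^sup>*" by auto
      then have "v \<in> spanned_verts S" "u \<in> spanned_verts S" unfolding V[symmetric]
        by (auto intro: rtrancl_into_rtrancl converse_rtrancl_into_rtrancl)
      moreover obtain b where "v = u @ [b]" using *(1) by (auto simp: complete_binary_tree_def)
      ultimately show "e \<in> cover (spanned_verts S)" by (auto simp: cover_spanned_verts)
    next
      assume "e \<in> cover (spanned_verts S)"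
      then obtain b where b: "v = u @ [b]" "u \<in> spanned_verts S" "v \<in> spanned_verts S" by (auto simp: cover_spanned_verts)
      then have "length v \<le> h" using assms(2) by (auto simp: spanned_verts_def dest!: prefix_length_le)
      then have "(u, v) \<in> edges ?T" using b(1) by (auto simp: complete_binary_tree_def)
      then show "e \<in> {(u, v) \<in> edges ?T. (?l, u) \<in> (edges ?T)\<^sup>* \<and> (\<exists>s\<in>S. (v, s) \<in> (edges ?T)\<^sup>*)}"
        using b(2,3) unfolding V[symmetric] by auto
    qed
  qed
  then show ?thesis
    unfolding spanned_subtree_def mrca_complete_binary_tree[OF assms] hasse_def V by blast
qed

definition branch_points :: "bool list set \<Rightarrow> bool list set" where
  "branch_points S = {v. v \<in> S \<or> (\<forall>b. \<exists>s\<in>S. prefix (v @ [b]) s)}"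

lemma outdeg_hasse_spanned_verts:
  assumes "v \<in> spanned_verts S"
  shows "outdeg (hasse (spanned_verts S) r) v = card {b. \<exists>s\<in>S. prefix (v @ [b]) s}"
proof -
  have "{w. (v, w) \<in> cover (spanned_verts S)} = (\<lambda>b. v @ [b]) ` {b. \<exists>s\<in>S. prefix (v @ [b]) s}"
    using assms by (auto simp: cover_spanned_verts spanned_verts_append_iff)
  then show ?thesis by (simp add: outdeg_def card_image inj_on_def)
qed

text \<open>At a spanned vertex the possible turns towards \<open>S\<close> form the empty set if
  the vertex is in \<open>S\<close>, as all members have equal length, and a nonempty set otherwise.
  With only two turns, a nonempty set has size other than 1 exactly when it contains both.\<close>

lemma branch_points_eq:
  assumes "\<forall>s\<in>S. length s = h"
  shows "branch_points S = {v \<in> spanned_verts S. outdeg (hasse (spanned_verts S) r) v \<noteq> 1}"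
proof -
  have "v \<in> branch_points S \<longleftrightarrow> card {b. \<exists>s\<in>S. prefix (v @ [b]) s} \<noteq> 1" if v: "v \<in> spanned_verts S" for v
  proof -
    let ?B = "{b. \<exists>s\<in>S. prefix (v @ [b]) s}"
    obtain s where s: "s \<in> S" "prefix v s" using v by (auto simp: spanned_verts_def)
    show ?thesis
    proof (cases "v \<in> S")
      case True
      then have "?B = {}" using assms by (force dest: prefix_length_le)
      then show ?thesis using True by (simp add: branch_points_def)
    next
      case False
      then have "strict_prefix v s" using s by (auto simp: strict_prefix_def)
      then obtain b z where "s = v @ b # z" by (rule strict_prefixE')
      then have "b \<in> ?B" using s(1) by (auto intro!: bexI[of _ s])
      then have "?B = {b} \<or> ?B = UNIV" by (auto simp: UNIV_bool)
      then have "card ?B \<noteq> 1 \<longleftrightarrow> ?B = UNIV" using card_UNIV_bool by force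
      moreover have "v \<in> branch_points S \<longleftrightarrow> ?B = UNIV" using False by (auto simp: branch_points_def)
      ultimately show ?thesis by simp
    qed
  qed
  moreover have "v \<in> spanned_verts S" if v: "v \<in> branch_points S" for v
  proof -
    have "\<exists>s\<in>S. prefix v s" using v append_prefixD[of v] by (fastforce simp: branch_points_def)
    moreover have "prefix (Longest_common_prefix S) v"
    proof (cases "v \<in> S")
      case True
      then show ?thesis by (rule Longest_common_prefix_prefix)
    next
      case False
      let ?l = "Longest_common_prefix S"
      \<comment> \<open>The longest common prefix lies below two lists that diverge right after
        \<open>v\<close>, so it cannot extend beyond \<open>v\<close>.\<close>
      have l: "\<exists>z. prefix ?l (v @ b # z)" for b
      proof -
        obtain s where "s \<in> S" "prefix (v @ [b]) s" using v False by (auto simp: branch_points_def)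
        then show ?thesis using Longest_common_prefix_prefix[of s S] by (auto simp: prefix_def)
      qed
      obtain x y where "prefix ?l (v @ True # x)" "prefix ?l (v @ False # y)" using l by blast
      then show ?thesis by (auto simp: prefix_append prefix_Cons)
    qed
    ultimately show ?thesis by (simp add: spanned_verts_def)
  qed
  ultimately show ?thesis
    unfolding set_eq_iff mem_Collect_eq using outdeg_hasse_spanned_verts[of _ S r] by metis
qed

lemma finite_spanned_verts: "finite S \<Longrightarrow> finite (spanned_verts S)"
proof -
  assume "finite S"
  have "spanned_verts S \<subseteq> (\<Union>s\<in>S. set (prefixes s))" by (auto simp: spanned_verts_def)
  then show ?thesis using \<open>finite S\<close> by (auto intro: finite_subset)
qed

text \<open>If one turn were missing after the longest common prefix, and this prefix were not
  itself in \<open>S\<close>, all of \<open>S\<close> would take the other turn and share a longer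
  prefix. This gives the root an outdegree other than 1, as \<open>contract_hasse_exists\<close>
  requires.\<close>

lemma lcp_in_branch_points:
  assumes "S \<noteq> {}" "\<forall>s\<in>S. length s = h"
  shows "Longest_common_prefix S \<in> branch_points S"
proof (rule ccontr)
  let ?l = "Longest_common_prefix S"
  assume "?l \<notin> branch_points S"
  then obtain b where b: "?l \<notin> S" "\<forall>s\<in>S. \<not> prefix (?l @ [b]) s" by (auto simp: branch_points_def)
  have "prefix (?l @ [\<not> b]) s" if "s \<in> S" for s
  proof -
    have "strict_prefix ?l s" using b(1) that Longest_common_prefix_prefix[OF that] by (auto simp: strict_prefix_def)
    then obtain c z where s: "s = ?l @ c # z" by (rule strict_prefixE')
    then have c: "prefix (?l @ [c]) s" by (simp add: prefix_def)
    then have "c \<noteq> b" using b(2) that by blast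
    then have "c = (\<not> b)" by simp
    then show ?thesis using c by simp
  qed
  then have "prefix (?l @ [\<not> b]) ?l" using assms(1) by (intro Longest_common_prefix_max_prefix) auto
  then show False by (simp add: prefix_def)
qed

text \<open>Uniqueness comes from the outdegree invariant, existence from termination; together they
  turn the relation into a function of \<open>S\<close>.\<close>

lemma induced_subtree_complete_binary_tree:
  assumes "S \<noteq> {}" "\<forall>s\<in>S. length s = h"
  shows "induced_subtree (complete_binary_tree h) S T' \<longleftrightarrow>
    T' = hasse (branch_points S) (Longest_common_prefix S)"
proof -
  let ?l = "Longest_common_prefix S"
  have "S \<subseteq> {s. set s \<subseteq> UNIV \<and> length s \<le> h}" using assms(2) by auto
  then have "finite S" using finite_lists_length_le[of "UNIV :: bool set" h] finite_subset by auto
  then have fin: "finite (spanned_verts S)" by (rule finite_spanned_verts)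
  have only: "T' = hasse (branch_points S) ?l"
    if T': "contract_step\<^sup>*\<^sup>* (hasse (spanned_verts S) ?l) T'" "\<forall>v\<in>verts T'. outdeg T' v \<noteq> 1" for T'
  proof -
    obtain W where W: "W \<subseteq> spanned_verts S" "T' = hasse W ?l"
      "\<forall>v\<in>W. outdeg T' v = outdeg (hasse (spanned_verts S) ?l) v"
      "\<forall>v\<in>spanned_verts S - W. outdeg (hasse (spanned_verts S) ?l) v = 1"
      using contract_steps_hasse[OF T'(1) fin] by blast
    then have "W = branch_points S" using T'(2) by (auto simp: branch_points_eq[OF assms(2), of ?l])
    then show ?thesis using W(2) by simp
  qed
  have l: "?l \<in> spanned_verts S" "outdeg (hasse (spanned_verts S) ?l) ?l \<noteq> 1"
    using lcp_in_branch_points[OF assms] branch_points_eq[OF assms(2), of ?l] by auto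
  obtain T where "contract_step\<^sup>*\<^sup>* (hasse (spanned_verts S) ?l) T" "\<forall>v\<in>verts T. outdeg T v \<noteq> 1"
    using contract_hasse_exists[OF fin l(1) _ l(2)] by (auto simp: spanned_verts_def)
  then show ?thesis
    using only unfolding induced_subtree_def spanned_subtree_complete_binary_tree[OF assms] by blast
qed

section \<open>The shape of an induced subtree, read off from its leaf set\<close>

text \<open>Passing over an empty half without adding a \<open>Node\<close> is the recursive
  counterpart of contraction and of moving the root down to the common ancestor.\<close>

primrec shape_of :: "nat \<Rightarrow> bool list set \<Rightarrow> shape" where
  "shape_of 0 S = Leaf"
| "shape_of (Suc h) S =
    (if Cons False -` S = {} then shape_of h (Cons True -` S)
     else if Cons True -` S = {} then shape_of h (Cons False -` S)
     else Node (Upair (shape_of h (Cons False -` S)) (shape_of h (Cons True -` S))))"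

lemma cover_Cons_image: "cover (Cons b ` V) = map_prod (Cons b) (Cons b) ` cover V"
proof (intro equalityI subsetI)
  fix e assume e: "e \<in> cover (Cons b ` V)"
  then obtain u v where "e = (b # u, b # v)" "u \<in> V" "v \<in> V" by (auto simp: cover_def)
  moreover from this have "(u, v) \<in> cover V" using e by (auto simp: cover_def)
  ultimately show "e \<in> map_prod (Cons b) (Cons b) ` cover V" by force
next
  fix e assume "e \<in> map_prod (Cons b) (Cons b) ` cover V"
  then show "e \<in> cover (Cons b ` V)" by (auto simp: cover_def)
qed

lemma cover_join:
  assumes "r \<in> V" "\<forall>v\<in>V. prefix r v" "q \<in> W" "\<forall>w\<in>W. prefix q w"
  shows "cover (insert [] (Cons False ` V \<union> Cons True ` W)) =
    insert ([], False # r) (insert ([], True # q)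
      (map_prod (Cons False) (Cons False) ` cover V \<union> map_prod (Cons True) (Cons True) ` cover W))"
proof -
  let ?U = "insert [] (Cons False ` V \<union> Cons True ` W)"
  have root: "([], b # v) \<in> cover ?U \<longleftrightarrow> v = (if b then q else r)" for b v
  proof
    assume *: "([], b # v) \<in> cover ?U"
    let ?m = "if b then q else r"
    have "b # ?m \<in> ?U" "prefix ?m v" using * assms by (auto simp: cover_def)
    \<comment> \<open>The least vertex of the half starting with \<open>b\<close> would otherwise
      lie strictly between \<open>[]\<close> and \<open>b # v\<close>.\<close>
    have "\<not> strict_prefix (b # ?m) (b # v)"
    proof
      assume "strict_prefix (b # ?m) (b # v)"
      then have "prefix (b # ?m) []" using * \<open>b # ?m \<in> ?U\<close> unfolding cover_def by blast
      then show False by simp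
    qed
    with \<open>prefix ?m v\<close> show "v = ?m" by (simp add: strict_prefix_def)
  next
    assume *: "v = (if b then q else r)"
    have "\<not> strict_prefix w r" if "w \<in> V" for w
      using assms(2) that by (meson prefix_order.less_le_not_le)
    moreover have "\<not> strict_prefix w q" if "w \<in> W" for w
      using assms(4) that by (meson prefix_order.less_le_not_le)
    ultimately show "([], b # v) \<in> cover ?U"
      using assms(1,3) * by (auto simp: cover_def)
  qed
  have nil: "(u, []) \<notin> cover ?U" for u by (auto simp: cover_def)
  have mixed: "(a # u, b # v) \<in> cover ?U \<Longrightarrow> a = b" for a b u v by (auto simp: cover_def)
  have F: "(False # u, False # v) \<in> cover ?U \<longleftrightarrow> (u, v) \<in> cover V" for u v
    by (auto simp: cover_def ball_Un)
  have T: "(True # u, True # v) \<in> cover ?U \<longleftrightarrow> (u, v) \<in> cover W" for u v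
    by (auto simp: cover_def ball_Un)
  show ?thesis
  proof (intro equalityI subsetI)
    fix e assume e: "e \<in> cover ?U"
    then obtain u b v where uv: "e = (u, b # v)" using nil by (metis list.exhaust surj_pair)
    show "e \<in> insert ([], False # r) (insert ([], True # q)
      (map_prod (Cons False) (Cons False) ` cover V \<union> map_prod (Cons True) (Cons True) ` cover W))"
    proof (cases u)
      case Nil
      then show ?thesis using e uv root by (cases b) auto
    next
      case (Cons a u')
      then have "a = b" using e uv mixed by blast
      then show ?thesis using e uv Cons F T by (cases b) force+
    qed
  next
    fix e assume "e \<in> insert ([], False # r) (insert ([], True # q)
      (map_prod (Cons False) (Cons False) ` cover V \<union> map_prod (Cons True) (Cons True) ` cover W))"
    then show "e \<in> cover ?U" using root[of False r] root[of True q] F T by auto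
  qed
qed

lemma branch_points_Cons_image:
  assumes "S \<noteq> {}"
  shows "branch_points (Cons b ` S) = Cons b ` branch_points S"
proof -
  have "[] \<notin> branch_points (Cons b ` S)"
    by (auto simp: branch_points_def intro!: exI[of _ "\<not> b"])
  moreover have "c # v \<in> branch_points (Cons b ` S) \<longleftrightarrow> c = b \<and> v \<in> branch_points S" for c v
    by (auto simp: branch_points_def)
  ultimately have "x \<in> branch_points (Cons b ` S) \<longleftrightarrow> x \<in> Cons b ` branch_points S" for x
    by (cases x) auto
  then show ?thesis by blast
qed

lemma branch_points_join:
  assumes "S \<noteq> {}" "S' \<noteq> {}"
  shows "branch_points (Cons False ` S \<union> Cons True ` S') =
    insert [] (Cons False ` branch_points S \<union> Cons True ` branch_points S')"
proof -
  let ?U = "Cons False ` S \<union> Cons True ` S'"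
  obtain s s' where "s \<in> S" "s' \<in> S'" using assms by blast
  then have "\<exists>u\<in>?U. prefix [b] u" for b
    by (cases b) (auto intro: bexI[of _ "True # s'"] bexI[of _ "False # s"])
  then have "[] \<in> branch_points ?U" by (simp add: branch_points_def)
  moreover have "c # v \<in> branch_points ?U \<longleftrightarrow> v \<in> branch_points (if c then S' else S)" for c v
    by (simp add: branch_points_def bex_Un image_iff)
  ultimately have "x \<in> branch_points ?U \<longleftrightarrow>
    x \<in> insert [] (Cons False ` branch_points S \<union> Cons True ` branch_points S')" for x
    by (cases x) auto
  then show ?thesis by blast
qed

lemma lcp_prefix_branch_points:
  "\<forall>s\<in>S. length s = h \<Longrightarrow> v \<in> branch_points S \<Longrightarrow> prefix (Longest_common_prefix S) v"
  using branch_points_eq[of S h] by (auto simp: spanned_verts_def)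

lemma bool_list_set_split:
  assumes "\<forall>s\<in>S. length s = Suc h"
  shows "S = Cons False ` (Cons False -` S) \<union> Cons True ` (Cons True -` S)"
proof -
  have "x \<in> S \<longleftrightarrow> x \<in> Cons False ` (Cons False -` S) \<union> Cons True ` (Cons True -` S)" for x
    using assms by (cases x; cases "hd x") auto
  then show ?thesis by blast
qed

text \<open>With one half empty, the diagram of the other half is merely shifted by a turn and keeps
  its shape. With both inhabited, \<open>[]\<close> is the common ancestor and the two shifted
  diagrams are glued below it.\<close>

lemma has_shape_branch_points:
  assumes "S \<noteq> {}" "\<forall>s\<in>S. length s = h"
  shows "has_shape (branch_points S) (cover (branch_points S)) (Longest_common_prefix S) (shape_of h S)"
  using assms
proof (induction h arbitrary: S)
  case 0
  then have "S = {[]}" by auto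
  moreover from this have "branch_points S = {[]}" by (auto simp: branch_points_def)
  moreover from this have "cover (branch_points S) = {}" by (auto simp: cover_def)
  ultimately show ?case by (simp add: has_shape_Leaf Longest_common_prefix_Nil)
next
  case (Suc h)
  define F where "F = Cons False -` S"
  define T where "T = Cons True -` S"
  have split: "S = Cons False ` F \<union> Cons True ` T"
    unfolding F_def T_def using Suc.prems(2) by (rule bool_list_set_split)
  have len: "\<forall>s\<in>F. length s = h" "\<forall>s\<in>T. length s = h" using Suc.prems(2) by (auto simp: F_def T_def)
  have shape: "shape_of (Suc h) S = (if F = {} then shape_of h T else if T = {} then shape_of h F
    else Node (Upair (shape_of h F) (shape_of h T)))" by (simp add: F_def T_def)
  have single: "has_shape (branch_points (Cons b ` R)) (cover (branch_points (Cons b ` R)))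
      (Longest_common_prefix (Cons b ` R)) (shape_of h R)"
    if "R \<noteq> {}" "\<forall>s\<in>R. length s = h" for b R
    using has_shape_image[OF Suc.IH[OF that], of "Cons b"] that(1)
    by (simp add: branch_points_Cons_image cover_Cons_image Longest_common_prefix_image_Cons)
  consider "F = {}" "T \<noteq> {}" "S = Cons True ` T" | "F \<noteq> {}" "T = {}" "S = Cons False ` F"
    | "F \<noteq> {}" "T \<noteq> {}"
    using split Suc.prems(1) by auto
  then show ?case
  proof cases
    case 1
    then have "shape_of (Suc h) S = shape_of h T" using shape by simp
    then show ?thesis using single[OF 1(2) len(2), of True] 1(3) by metis
  next
    case 2
    then have "shape_of (Suc h) S = shape_of h F" using shape by simp
    then show ?thesis using single[OF 2(1) len(1), of False] 2(3) by metis
  next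
    case 3
    let ?lF = "Longest_common_prefix F" and ?lT = "Longest_common_prefix T"
    have B: "branch_points S = insert [] (Cons False ` branch_points F \<union> Cons True ` branch_points T)"
      using branch_points_join[OF 3] split by simp
    have C: "cover (branch_points S) = insert ([], False # ?lF) (insert ([], True # ?lT)
      (map_prod (Cons False) (Cons False) ` cover (branch_points F) \<union>
       map_prod (Cons True) (Cons True) ` cover (branch_points T)))"
      unfolding B using lcp_prefix_branch_points len lcp_in_branch_points 3
      by (intro cover_join) blast+
    obtain p q where "False # p \<in> S" "True # q \<in> S" using 3 by (auto simp: F_def T_def)
    then have "Longest_common_prefix S = []" by (rule Longest_common_prefix_eq_Nil) simp
    moreover have "shape_of (Suc h) S = Node (Upair (shape_of h F) (shape_of h T))" using 3 shape by simp
    moreover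
    have "has_shape (Cons False ` branch_points F) (map_prod (Cons False) (Cons False) ` cover (branch_points F))
      (False # ?lF) (shape_of h F)"
      "has_shape (Cons True ` branch_points T) (map_prod (Cons True) (Cons True) ` cover (branch_points T))
      (True # ?lT) (shape_of h T)"
      by (rule has_shape_image[OF Suc.IH[OF 3(1) len(1)]], simp)
        (rule has_shape_image[OF Suc.IH[OF 3(2) len(2)]], simp)
    then have "has_shape (branch_points S) (cover (branch_points S)) []
      (Node (Upair (shape_of h F) (shape_of h T)))"
      unfolding C unfolding B by (rule has_shape_Node) auto
    ultimately show ?thesis by simp
  qed
qed

section \<open>Counting shapes of bounded height\<close>

primrec shapes :: "nat \<Rightarrow> shape set" where
  "shapes 0 = {Leaf}"
| "shapes (Suc h) = insert Leaf (Node ` (\<lambda>(s, t). Upair s t) ` (shapes h \<times> shapes h))"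

lemma shapes_mono: "shapes h \<subseteq> shapes (Suc h)"
proof (induction h)
  case (Suc h)
  then have "shapes h \<times> shapes h \<subseteq> shapes (Suc h) \<times> shapes (Suc h)" by blast
  then show ?case unfolding shapes.simps(2)[of h] shapes.simps(2)[of "Suc h"] by blast
qed simp

text \<open>An empty half yields a shape of the previous level, which \<open>shapes_mono\<close>
  absorbs. Conversely a node is realised by leaf sets for its children in the two halves, and
  \<open>Leaf\<close> by a leaf set in one half alone.\<close>

lemma shape_of_image: "shape_of h ` {S. S \<noteq> {} \<and> (\<forall>s\<in>S. length s = h)} = shapes h"
proof (induction h)
  case 0
  have "{S :: bool list set. S \<noteq> {} \<and> (\<forall>s\<in>S. length s = 0)} \<noteq> {}" by (auto intro: exI[of _ "{[]}"])
  then show ?case by auto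
next
  case (Suc h)
  show ?case
  proof (intro equalityI subsetI)
    fix x assume "x \<in> shape_of (Suc h) ` {S. S \<noteq> {} \<and> (\<forall>s\<in>S. length s = Suc h)}"
    then obtain S where S: "x = shape_of (Suc h) S" "S \<noteq> {}" "\<forall>s\<in>S. length s = Suc h" by blast
    have *: "shape_of h (Cons b -` S) \<in> shapes h" if "Cons b -` S \<noteq> {}" for b
      unfolding Suc[symmetric] by (rule imageI) (use that S(3) in auto)
    have "\<not> (Cons False -` S = {} \<and> Cons True -` S = {})"
      using bool_list_set_split[OF S(3)] S(2) by (metis image_empty sup_bot_left)
    then show "x \<in> shapes (Suc h)"
      using *[of True] *[of False] shapes_mono[of h] S(1) by (cases "Cons False -` S = {}"; cases "Cons True -` S = {}") auto
  next
    fix x assume "x \<in> shapes (Suc h)"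
    have pre: "\<exists>S. S \<noteq> {} \<and> (\<forall>s\<in>S. length s = h) \<and> s = shape_of h S" if "s \<in> shapes h" for s
      using that unfolding Suc[symmetric] by blast
    from \<open>x \<in> shapes (Suc h)\<close> consider "x = Leaf" | s t where "s \<in> shapes h" "t \<in> shapes h" "x = Node (Upair s t)"
      by auto
    then show "x \<in> shape_of (Suc h) ` {S. S \<noteq> {} \<and> (\<forall>s\<in>S. length s = Suc h)}"
    proof cases
      case 1
      have "Leaf \<in> shapes h" by (cases h) auto
      then obtain S where S: "S \<noteq> {}" "\<forall>s\<in>S. length s = h" "Leaf = shape_of h S" using pre by blast
      have "Cons False -` (Cons True ` S) = {}" "Cons True -` (Cons True ` S) = S" by auto
      then have "x = shape_of (Suc h) (Cons True ` S)" using S 1 by simp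
      moreover have "\<forall>s\<in>Cons True ` S. length s = Suc h" using S(2) by auto
      ultimately show ?thesis using S(1) by blast
    next
      case 2
      obtain S where S: "S \<noteq> {}" "\<forall>s\<in>S. length s = h" "s = shape_of h S" using pre[OF 2(1)] by blast
      obtain R where R: "R \<noteq> {}" "\<forall>s\<in>R. length s = h" "t = shape_of h R" using pre[OF 2(2)] by blast
      have "Cons False -` (Cons False ` S \<union> Cons True ` R) = S"
        "Cons True -` (Cons False ` S \<union> Cons True ` R) = R" by auto
      then have "x = shape_of (Suc h) (Cons False ` S \<union> Cons True ` R)" using S R 2(3) by simp
      moreover have "\<forall>s\<in>Cons False ` S \<union> Cons True ` R. length s = Suc h" using S(2) R(2) by auto
      ultimately show ?thesis using S(1) by blast
    qed
  qed
qed

text \<open>An unordered pair is determined by its set of elements, which is either a singleton or a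
  two-element subset.\<close>

lemma card_Upair_image:
  assumes "finite A"
  shows "card ((\<lambda>(s, t). Upair s t) ` (A \<times> A)) = card A + (card A choose 2)"
proof -
  let ?U = "(\<lambda>(s, t). Upair s t) ` (A \<times> A)"
  have "inj_on set_uprod ?U" by (auto simp: inj_on_def doubleton_eq_iff)
  then have "card ?U = card (set_uprod ` ?U)" by (simp add: card_image)
  also have "set_uprod ` ?U = (\<lambda>a. {a}) ` A \<union> {X. X \<subseteq> A \<and> card X = 2}"
    by (auto simp: image_iff card_2_iff) (metis insert_absorb2)+
  also have "card \<dots> = card ((\<lambda>a. {a}) ` A) + card {X. X \<subseteq> A \<and> card X = 2}"
    using assms by (intro card_Un_disjoint) auto
  also have "\<dots> = card A + (card A choose 2)" using assms by (simp add: n_subsets card_image)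
  finally show ?thesis .
qed

lemma finite_shapes: "finite (shapes h)"
  by (induction h) auto

lemma card_shapes_Suc: "card (shapes (Suc h)) = 1 + card (shapes h) + (card (shapes h) choose 2)"
proof -
  let ?U = "(\<lambda>(s, t). Upair s t) ` (shapes h \<times> shapes h)"
  have "card (shapes (Suc h)) = Suc (card (Node ` ?U))"
    using finite_shapes by (subst shapes.simps(2), subst card_insert_disjoint) auto
  also have "card (Node ` ?U) = card ?U" by (intro card_image) (simp add: inj_on_def)
  finally show ?thesis using card_Upair_image[OF finite_shapes] by simp
qed

text \<open>The classes are the nonempty fibres of the complete invariant \<open>f\<close>.\<close>

lemma card_quotient_by_invariant:
  assumes "\<And>x y. x \<in> X \<Longrightarrow> y \<in> X \<Longrightarrow> r x y \<longleftrightarrow> f x = f y"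
  shows "card (X // {(x, y). x \<in> X \<and> y \<in> X \<and> r x y}) = card (f ` X)"
proof -
  have "bij_betw (\<lambda>c. {x \<in> X. f x = c}) (f ` X) (X // {(x, y). x \<in> X \<and> y \<in> X \<and> r x y})"
    unfolding bij_betw_def
  proof
    show "inj_on (\<lambda>c. {x \<in> X. f x = c}) (f ` X)" by (rule inj_onI) blast
    have "{(x, y). x \<in> X \<and> y \<in> X \<and> r x y} `` {x} = {y \<in> X. f y = f x}" if "x \<in> X" for x
      using that assms by auto
    then show "(\<lambda>c. {x \<in> X. f x = c}) ` f ` X = X // {(x, y). x \<in> X \<and> y \<in> X \<and> r x y}"
      by (auto simp: quotient_def)
  qed
  then show ?thesis by (rule bij_betw_same_card[symmetric])
qed

lemma num_leaf_induced_eq_card_shapes: "num_leaf_induced (complete_binary_tree h) = card (shapes h)"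
proof -
  let ?X = "leaf_induced_subtrees (complete_binary_tree h)"
  let ?S = "{S. S \<noteq> {} \<and> (\<forall>s\<in>S. length s = h)} :: bool list set set"
  define G where "G S = hasse (branch_points S) (Longest_common_prefix S)" for S
  \<comment> \<open>The choice of leaf set is harmless: \<open>shape_at\<close> recovers the shape
    from the graph alone, so every \<open>S\<close> with \<open>T = G S\<close> gives the same
    value.\<close>
  define f where "f T = shape_of h (SOME S. S \<in> ?S \<and> T = G S)" for T
  have "S \<noteq> {} \<and> S \<subseteq> leaves (complete_binary_tree h) \<and> induced_subtree (complete_binary_tree h) S T \<longleftrightarrow>
      S \<in> ?S \<and> T = G S" for S T
    using induced_subtree_complete_binary_tree[of S h T]
    by (auto simp: leaves_complete_binary_tree G_def subset_iff)
  then have "?X = {T. \<exists>S. S \<in> ?S \<and> T = G S}" by (simp only: leaf_induced_subtrees_def)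
  then have X: "?X = G ` ?S" by (simp add: image_def Bex_def)
  have hs: "has_shape (verts (G S)) (edges (G S)) (root (G S)) (shape_of h S)" if "S \<in> ?S" for S
    using has_shape_branch_points[of S h] that by (simp add: G_def)
  have f: "f (G S) = shape_of h S" if S: "S \<in> ?S" for S
  proof -
    have "\<exists>S'. S' \<in> ?S \<and> G S = G S'" using S by blast
    then have *: "(SOME S'. S' \<in> ?S \<and> G S = G S') \<in> ?S \<and> G S = G (SOME S'. S' \<in> ?S \<and> G S = G S')"
      by (rule someI_ex)
    let ?S' = "SOME S'. S' \<in> ?S \<and> G S = G S'"
    have "has_shape (verts (G S)) (edges (G S)) (root (G S)) (shape_of h ?S')"
      using hs[of ?S'] * by simp
    with hs[OF S] show ?thesis
      unfolding f_def by (blast dest: has_shape_imp_shape_at intro: shape_at_deterministic)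
  qed
  have "isomorphic T T' \<longleftrightarrow> f T = f T'" if "T \<in> ?X" "T' \<in> ?X" for T T'
  proof -
    obtain S where S: "T = G S" "S \<in> ?S" using \<open>T \<in> ?X\<close> unfolding X by (rule imageE)
    obtain S' where S': "T' = G S'" "S' \<in> ?S" using \<open>T' \<in> ?X\<close> unfolding X by (rule imageE)
    show ?thesis
      using isomorphic_iff_same_shape[OF hs[OF S(2)] hs[OF S'(2)]] f[OF S(2)] f[OF S'(2)] S(1) S'(1) by simp
  qed
  then have "num_leaf_induced (complete_binary_tree h) = card (f ` ?X)"
    unfolding num_leaf_induced_def by (rule card_quotient_by_invariant)
  also have "f ` ?X = shape_of h ` ?S" unfolding X image_image using f by (intro image_cong) auto
  also have "\<dots> = shapes h" by (rule shape_of_image)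
  finally show ?thesis .
qed

lemma num_leaf_induced_0: "num_leaf_induced (complete_binary_tree 0) = 1"
  by (simp add: num_leaf_induced_eq_card_shapes)

lemma num_leaf_induced_Suc:
  "num_leaf_induced (complete_binary_tree (Suc h)) =
    1 + num_leaf_induced (complete_binary_tree h) * (num_leaf_induced (complete_binary_tree h) + 1) div 2"
proof -
  have "1 + n + (n choose 2) = 1 + n * (n + 1) div 2" for n :: nat
    by (cases n) (auto simp: choose_two algebra_simps)
  then show ?thesis unfolding num_leaf_induced_eq_card_shapes card_shapes_Suc .
qed

section \<open>The growth constant\<close>

text \<open>Halving makes the recursion monic, and it turns the argument of the logarithm in
  \<open>kappa_term\<close> into the quotient of a value by the square of its predecessor.\<close>

definition half_count :: "nat \<Rightarrow> real" where
  "half_count h = real (num_leaf_induced (complete_binary_tree h)) / 2"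

lemma half_count_0: "half_count 0 = 1 / 2"
  by (simp add: half_count_def num_leaf_induced_0)

lemma half_count_Suc: "half_count (Suc h) = (half_count h)\<^sup>2 + half_count h / 2 + 1 / 2"
proof -
  let ?n = "num_leaf_induced (complete_binary_tree h)"
  have "2 dvd ?n * (?n + 1)" by simp
  then have "real (?n * (?n + 1) div 2) = real ?n * (real ?n + 1) / 2"
    by (simp add: real_of_nat_div algebra_simps)
  then show ?thesis
    unfolding half_count_def num_leaf_induced_Suc by (simp add: power2_eq_square field_simps)
qed

lemma half_count_ge: "half_count h \<ge> 1 / 2"
  by (cases h) (simp_all add: half_count_0 half_count_Suc, simp add: half_count_def)

lemma kappa_term_eq: "kappa_term j = ln (half_count (Suc j) / (half_count j)\<^sup>2) / 2 ^ Suc j"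
proof -
  have "2 powr (- 1 - real j) = 2 powr (- real (Suc j))" by simp
  also have "\<dots> = 1 / 2 ^ Suc j" by (subst powr_minus_divide, subst powr_realpow) simp_all
  finally show ?thesis
    by (simp add: kappa_term_def half_count_def power2_eq_square)
qed

text \<open>The terms telescope as differences of \<open>ln (half_count n) / 2 ^ n\<close>. The
  initial value \<open>half_count 0 = 1 / 2\<close> leaves \<open>ln 2\<close>, which the
  \<open>- ln 2\<close> in \<open>kappa\<close> cancels.\<close>

lemma sum_kappa_term: "(\<Sum>j<n. kappa_term j) = ln 2 + ln (half_count n) / 2 ^ n"
proof (induction n)
  case 0
  show ?case by (simp add: half_count_0 ln_div)
next
  case (Suc n)
  have "half_count n > 0" "half_count (Suc n) > 0" using half_count_ge[of n] half_count_ge[of "Suc n"] by linarith+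
  then have "kappa_term n = (ln (half_count (Suc n)) - 2 * ln (half_count n)) / 2 ^ Suc n"
    by (simp add: kappa_term_eq ln_div ln_realpow)
  then show ?case using Suc by (simp add: field_simps)
qed

text \<open>For x at least 1/2 one has x/2 \<le> x^2 and 1/2 \<le> 2 x^2, so the recursion keeps the
  quotient inside the logarithm between 1 and 4.\<close>

lemma kappa_term_bounds: "0 \<le> kappa_term j" "kappa_term j \<le> ln 4 * (1 / 2) ^ j"
proof -
  let ?x = "half_count j" and ?r = "half_count (Suc j) / (half_count j)\<^sup>2"
  have x: "?x \<ge> 1 / 2" by (rule half_count_ge)
  then have x2: "?x\<^sup>2 > 0" "?x * (1 / 2) \<le> ?x * ?x" "1 / 4 \<le> ?x * ?x"
    using mult_mono[of "1/2" ?x "1/2" ?x] by (auto intro: mult_left_mono)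
  have "?r \<ge> 1" using x x2 by (simp add: half_count_Suc field_simps)
  moreover have "half_count (Suc j) \<le> 4 * ?x\<^sup>2"
    unfolding half_count_Suc power2_eq_square using x2(2,3) by linarith
  then have "?r \<le> 4" using x2(1) by (simp add: field_simps)
  ultimately have "0 \<le> ln ?r" "ln ?r \<le> ln 4" by simp_all
  then show "0 \<le> kappa_term j" "kappa_term j \<le> ln 4 * (1 / 2) ^ j"
    unfolding kappa_term_eq by (auto simp: field_simps)
qed

lemma summable_kappa_term: "summable kappa_term"
proof (rule summable_comparison_test')
  show "summable (\<lambda>j. ln 4 * (1 / 2 :: real) ^ j)" by (intro summable_mult summable_geometric) simp
  show "norm (kappa_term j) \<le> ln 4 * (1 / 2) ^ j" if "j \<ge> 0" for j
    using kappa_term_bounds[of j] by simp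
qed

lemma ln_half_count_tendsto: "(\<lambda>n. ln (half_count n) / 2 ^ n) \<longlonglongrightarrow> ln kappa"
proof -
  have "(\<lambda>n. - ln 2 + (\<Sum>j<n. kappa_term j)) \<longlonglongrightarrow> - ln 2 + (\<Sum>j. kappa_term j)"
    by (intro tendsto_intros summable_LIMSEQ summable_kappa_term)
  then show ?thesis by (simp add: sum_kappa_term kappa_def)
qed

text \<open>A bounded factor \<open>C\<close> changes the normalised logarithm by at most
  \<open>ln C / 2 ^ n\<close>, which vanishes in the limit. Both bounding sequences for
  \<open>kappa\<close> are treated this way.\<close>

lemma ln_comparable_tendsto:
  assumes "\<And>n. half_count n \<le> l n" "\<And>n. l n \<le> C * half_count n"
  shows "(\<lambda>n. ln (l n) / 2 ^ n) \<longlonglongrightarrow> ln kappa"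
proof -
  have pos: "half_count n > 0" for n using half_count_ge[of n] by linarith
  have "C > 0" using assms[of 0] pos[of 0] by (metis less_le_trans zero_less_mult_pos2)
  have lim: "(\<lambda>n. ln C / 2 ^ n) \<longlonglongrightarrow> 0"
    by (rule tendsto_divide_0[OF tendsto_const]) (simp add: filterlim_at_top_imp_at_infinity filterlim_realpow_sequentially_gt1)
  have "(\<lambda>n. ln C / 2 ^ n + ln (half_count n) / 2 ^ n) \<longlonglongrightarrow> 0 + ln kappa"
    by (intro tendsto_add lim ln_half_count_tendsto)
  then have up: "(\<lambda>n. ln C / 2 ^ n + ln (half_count n) / 2 ^ n) \<longlonglongrightarrow> ln kappa" by simp
  have "ln (half_count n) / 2 ^ n \<le> ln (l n) / 2 ^ n" for n
    using assms(1)[of n] pos[of n] by (simp add: divide_right_mono)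
  moreover have "ln (l n) / 2 ^ n \<le> ln C / 2 ^ n + ln (half_count n) / 2 ^ n" for n
  proof -
    have "ln (l n) \<le> ln (C * half_count n)" using assms[of n] pos[of n] by simp
    also have "\<dots> = ln C + ln (half_count n)" using \<open>C > 0\<close> pos[of n] by (simp add: ln_mult)
    finally show ?thesis by (simp add: add_divide_distrib[symmetric] divide_right_mono)
  qed
  ultimately show ?thesis
    by (intro tendsto_sandwich[OF _ _ ln_half_count_tendsto up]) auto
qed

lemma kappa_pos: "kappa > 0"
  by (simp add: kappa_def)

lemma le_kappa_power_if_ln_le:
  assumes "0 < a" "ln a / 2 ^ n \<le> ln kappa"
  shows "a \<le> kappa ^ 2 ^ n"
proof -
  have "ln a \<le> ln (kappa ^ 2 ^ n)" using assms(2) kappa_pos by (simp add: ln_realpow field_simps)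
  then show ?thesis using assms(1) kappa_pos by simp
qed

lemma kappa_power_le_if_ln_le:
  assumes "0 < a" "ln kappa \<le> ln a / 2 ^ n"
  shows "kappa ^ 2 ^ n \<le> a"
proof -
  have "ln (kappa ^ 2 ^ n) \<le> ln a" using assms(2) kappa_pos by (simp add: ln_realpow field_simps)
  then show ?thesis using assms(1) kappa_pos by simp
qed

text \<open>Completing the square in the recursion of \<^const>\<open>half_count\<close> removes the linear term.\<close>

definition shifted_count :: "nat \<Rightarrow> real" where
  "shifted_count h = half_count h + 1 / 4"

lemma shifted_count_Suc: "shifted_count (Suc h) = (shifted_count h)\<^sup>2 + 11 / 16"
  by (simp add: shifted_count_def half_count_Suc power2_eq_square algebra_simps)

lemma shifted_count_ge: "shifted_count h \<ge> 3 / 4"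
  using half_count_ge[of h] by (simp add: shifted_count_def)

text \<open>The threshold 2 makes the correction 1/(2y) smaller than 1/4. It is passed at
  \<open>h = 2\<close> with value 9/4, whereas \<open>h = 1\<close> gives only 5/4; there the floor
  formula fails, since 2 kappa^2 exceeds 3 while the count is 2.\<close>

lemma shifted_count_ge2: "h \<ge> 2 \<Longrightarrow> shifted_count h > 2"
proof (induction h rule: dec_induct)
  case base
  show ?case using half_count_Suc[of 0] half_count_Suc[of 1]
    by (simp add: half_count_0 shifted_count_def power2_eq_square numeral_2_eq_2)
next
  case (step h)
  have "2 * 2 < shifted_count h * shifted_count h" using step by (intro mult_strict_mono) auto
  then show ?case by (simp add: shifted_count_Suc power2_eq_square)
qed

lemma shifted_count_le_kappa_power: "shifted_count n \<le> kappa ^ 2 ^ n"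
proof (rule le_kappa_power_if_ln_le)
  have pos: "shifted_count m > 0" for m using shifted_count_ge[of m] by linarith
  then show "0 < shifted_count n" .
  have "(\<lambda>m. ln (shifted_count m) / 2 ^ m) \<longlonglongrightarrow> ln kappa"
  proof (rule ln_comparable_tendsto)
    show "half_count m \<le> shifted_count m" "shifted_count m \<le> 2 * half_count m" for m
      using half_count_ge[of m] by (auto simp: shifted_count_def)
  qed
  moreover have "incseq (\<lambda>m. ln (shifted_count m) / 2 ^ m)"
  proof (rule incseq_SucI)
    fix m
    have "2 * ln (shifted_count m) = ln ((shifted_count m)\<^sup>2)" using pos[of m] by (simp add: ln_realpow)
    also have "\<dots> \<le> ln (shifted_count (Suc m))"
      using pos[of m] pos[of "Suc m"] by (subst ln_le_cancel_iff) (simp_all add: shifted_count_Suc)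
    finally show "ln (shifted_count m) / 2 ^ m \<le> ln (shifted_count (Suc m)) / 2 ^ Suc m"
      by (simp add: field_simps)
  qed
  ultimately show "ln (shifted_count n) / 2 ^ n \<le> ln kappa" by (rule incseq_le[rotated])
qed

text \<open>The exact correction term is about \<open>11 / (32 * shifted_count n)\<close>; the larger coefficient
  \<open>1 / 2\<close> makes the squares of the bounds dominate the next bound.\<close>

lemma kappa_power_le_shifted_count: "kappa ^ 2 ^ n \<le> shifted_count n + 1 / (2 * shifted_count n)"
proof (rule kappa_power_le_if_ln_le)
  define u where "u m = shifted_count m + 1 / (2 * shifted_count m)" for m
  have pos: "shifted_count m > 0" for m using shifted_count_ge[of m] by linarith
  then have upos: "u m > 0" for m by (simp add: u_def add_pos_pos)
  then show "0 < shifted_count n + 1 / (2 * shifted_count n)" by (simp add: u_def)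
  have "(\<lambda>m. ln (u m) / 2 ^ m) \<longlonglongrightarrow> ln kappa"
  \<comment> \<open>The factor 3 suffices because the excess over \<open>half_count m\<close> is at
    most 1/4 + 2/3 < 1, and 1 is at most \<open>2 * half_count m\<close>.\<close>
  proof (rule ln_comparable_tendsto[where C = 3])
    fix m
    show "half_count m \<le> u m" using pos[of m] by (simp add: u_def shifted_count_def)
    have "1 / (2 * shifted_count m) \<le> 2 / 3" using shifted_count_ge[of m] by (simp add: field_simps)
    then show "u m \<le> 3 * half_count m" using half_count_ge[of m] by (simp add: u_def shifted_count_def)
  qed
  moreover have "decseq (\<lambda>m. ln (u m) / 2 ^ m)"
  proof (rule decseq_SucI)
    fix m
    let ?y = "shifted_count m"
    define q where "q = ?y\<^sup>2"
    have "q > 0" using pos[of m] by (simp add: q_def)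
    have "2 * q \<le> q\<^sup>2 + 1" using zero_le_power2[of "q - 1"] by (simp add: power2_diff)
    moreover have "0 \<le> q\<^sup>2" by simp
    \<comment> \<open>Clearing denominators in the next inequality leads to this quadratic. That
      inequality is precisely u(m+1) \<le> u(m)^2, with 5/16 = 1 - 11/16 left over from the constant
      terms.\<close>
    ultimately have "0 \<le> 160 * q\<^sup>2 - 18 * q + 88" by linarith
    then have "1 / (2 * (q + 11 / 16)) \<le> 5 / 16 + 1 / (4 * q)"
      using \<open>q > 0\<close> by (simp add: divide_simps power2_eq_square algebra_simps)
    moreover have "(u m)\<^sup>2 = q + 1 + 1 / (4 * q)"
      using pos[of m] by (simp add: u_def q_def power2_sum power_divide power_mult_distrib)
    moreover have "u (Suc m) = q + 11 / 16 + 1 / (2 * (q + 11 / 16))"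
      by (simp add: u_def shifted_count_Suc q_def)
    ultimately have "u (Suc m) \<le> (u m)\<^sup>2" by linarith
    then have "ln (u (Suc m)) \<le> ln ((u m)\<^sup>2)" using upos[of m] upos[of "Suc m"] by simp
    also have "\<dots> = 2 * ln (u m)" using upos[of m] by (simp add: ln_realpow)
    finally show "ln (u (Suc m)) / 2 ^ Suc m \<le> ln (u m) / 2 ^ m" by (simp add: field_simps)
  qed
  ultimately have "ln kappa \<le> ln (u n) / 2 ^ n" by (rule decseq_ge[rotated])
  then show "ln kappa \<le> ln (shifted_count n + 1 / (2 * shifted_count n)) / 2 ^ n" by (simp add: u_def)
qed

text \<open>The two bounds enclose the value between N + 1/2 and N + 1, the upper end
  excluded.\<close>

lemma floor_two_kappa_power:
  assumes "h \<ge> 2"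
  shows "int (num_leaf_induced (complete_binary_tree h)) = \<lfloor>2 * kappa ^ 2 ^ h\<rfloor>"
proof -
  let ?y = "shifted_count h" and ?n = "num_leaf_induced (complete_binary_tree h)"
  have "1 / (2 * ?y) < 1 / 4" using shifted_count_ge2[OF assms] by (simp add: field_simps)
  then have "2 * kappa ^ 2 ^ h < 2 * ?y + 1 / 2" using kappa_power_le_shifted_count[of h] by linarith
  moreover have "2 * ?y \<le> 2 * kappa ^ 2 ^ h" using shifted_count_le_kappa_power[of h] by linarith
  moreover have "2 * ?y = real ?n + 1 / 2" by (simp add: shifted_count_def half_count_def)
  ultimately have "\<lfloor>2 * kappa ^ 2 ^ h\<rfloor> = int ?n" by (intro floor_unique) auto
  then show ?thesis ..
qed

section \<open>Decimals of kappa by repeated square roots\<close>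

text \<open>A root is never computed: a proposed bound is checked by squaring it. The premise
  \<open>m = Suc n\<close> lets the rule match exponents written as numerals.\<close>

lemma kappa_ge_square_root:
  assumes "b \<le> kappa ^ 2 ^ m" "m = Suc n" "a\<^sup>2 \<le> b"
  shows "a \<le> kappa ^ 2 ^ n"
proof -
  have "a\<^sup>2 \<le> (kappa ^ 2 ^ n)\<^sup>2" using assms by (simp add: power_mult[symmetric] mult.commute)
  then show ?thesis using kappa_pos by (auto intro: power2_le_imp_le)
qed

lemma kappa_less_square_root:
  assumes "kappa ^ 2 ^ m < b" "m = Suc n" "b \<le> a\<^sup>2" "0 \<le> a"
  shows "kappa ^ 2 ^ n < a"
proof -
  have "(kappa ^ 2 ^ n)\<^sup>2 < a\<^sup>2" using assms by (simp add: power_mult[symmetric] mult.commute)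
  then show ?thesis using assms(4) by (rule power2_less_imp_less)
qed

text \<open>The enclosure at \<open>h\<close> has relative width about 1/(2 y^2), divided by 2^h
  after the roots are taken. Height 8 leaves an uncertainty of order 10^(-52) in kappa, too coarse
  for 55 decimals; height 9 brings it to order 10^(-101).\<close>

lemma num_leaf_induced_9: "num_leaf_induced (complete_binary_tree 9) = 16217557574922386301420536972254869595782763547561"
proof -
  have N1: "num_leaf_induced (complete_binary_tree 1) = 2"
    using num_leaf_induced_Suc[of 0] num_leaf_induced_0 by simp
  have N2: "num_leaf_induced (complete_binary_tree 2) = 4"
    using num_leaf_induced_Suc[of 1] N1 by (simp flip: numeral_2_eq_2)
  have N3: "num_leaf_induced (complete_binary_tree 3) = 11"
    using num_leaf_induced_Suc[of 2] N2 by simp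
  have N4: "num_leaf_induced (complete_binary_tree 4) = 67"
    using num_leaf_induced_Suc[of 3] N3 by simp
  have N5: "num_leaf_induced (complete_binary_tree 5) = 2279"
    using num_leaf_induced_Suc[of 4] N4 by simp
  have N6: "num_leaf_induced (complete_binary_tree 6) = 2598061"
    using num_leaf_induced_Suc[of 5] N5 by simp
  have N7: "num_leaf_induced (complete_binary_tree 7) = 3374961778892"
    using num_leaf_induced_Suc[of 6] N6 by simp
  have N8: "num_leaf_induced (complete_binary_tree 8) = 5695183504492614029263279"
    using num_leaf_induced_Suc[of 7] N7 by simp
  have N9: "num_leaf_induced (complete_binary_tree 9) = 16217557574922386301420536972254869595782763547561"
    using num_leaf_induced_Suc[of 8] N8 by simp
  from N9 show ?thesis .
qed

text \<open>The numbers in the next two proofs come from squaring the decimal approximation repeatedly and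
  rounding outwards to 57 significant digits, which keeps them small.\<close>

lemma kappa_ge_55_digits: "12460208329836625089431529441999359284665241772983812581 / 10 ^ 55 \<le> kappa"
proof -
  have "810877878746119315071026848612743479789138177378074975226 / 10 ^ 8 \<le> kappa ^ 2 ^ 9"
    using shifted_count_le_kappa_power[of 9]
    by (simp add: shifted_count_def half_count_def num_leaf_induced_9)
  then have "284759175224630701463163975000000000000000000000012067254 / 10 ^ 32 \<le> kappa ^ 2 ^ 8"
    by (rule kappa_ge_square_root) (simp_all add: divide_simps)
  then have "168748088944625000000000020370601062794980948508830022399 / 10 ^ 44 \<le> kappa ^ 2 ^ 7"
    by (rule kappa_ge_square_root) (simp_all add: divide_simps)
  then have "129903075000026462037176569287604218550496284946389446672 / 10 ^ 50 \<le> kappa ^ 2 ^ 6"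
    by (rule kappa_ge_square_root) (simp_all add: divide_simps)
  then have "113975030160130452161652842816821510177417034449625339464 / 10 ^ 53 \<le> kappa ^ 2 ^ 5"
    by (rule kappa_ge_square_root) (simp_all add: divide_simps)
  then have "337601881156089608898371150975274103674007083620088525816 / 10 ^ 55 \<le> kappa ^ 2 ^ 4"
    by (rule kappa_ge_square_root) (simp_all add: divide_simps)
  then have "581035180652677526748365905359560338332955666448373373363 / 10 ^ 56 \<le> kappa ^ 2 ^ 3"
    by (rule kappa_ge_square_root) (simp_all add: divide_simps)
  then have "241046713450459126302052428458436626520043268314519884415 / 10 ^ 56 \<le> kappa ^ 2 ^ 2"
    by (rule kappa_ge_square_root) (simp_all add: divide_simps)
  then have "155256791622930018056870167597084592579722541291327604264 / 10 ^ 56 \<le> kappa ^ 2 ^ 1"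
    by (rule kappa_ge_square_root) (simp_all add: divide_simps)
  then have "12460208329836625089431529441999359284665241772983812581 / 10 ^ 55 \<le> kappa ^ 2 ^ 0"
    by (rule kappa_ge_square_root) (simp_all add: divide_simps)
  then show ?thesis by simp
qed

lemma kappa_less_55_digits: "12460208329836625089431529441999359284665241772983812582 / 10 ^ 55 > kappa"
proof -
  have "810877878746119315071026848612743479789138177378075006703 / 10 ^ 8 > kappa ^ 2 ^ 9"
    using kappa_power_le_shifted_count[of 9]
    by (simp add: shifted_count_def half_count_def num_leaf_induced_9)
  then have "284759175224630701463163975000000000000000000000012072781 / 10 ^ 32 > kappa ^ 2 ^ 8"
    by (rule kappa_less_square_root) (simp_all add: divide_simps)
  then have "168748088944625000000000020370601062794980948508830024037 / 10 ^ 44 > kappa ^ 2 ^ 7"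
    by (rule kappa_less_square_root) (simp_all add: divide_simps)
  then have "129903075000026462037176569287604218550496284946389447303 / 10 ^ 50 > kappa ^ 2 ^ 6"
    by (rule kappa_less_square_root) (simp_all add: divide_simps)
  then have "113975030160130452161652842816821510177417034449625339741 / 10 ^ 53 > kappa ^ 2 ^ 5"
    by (rule kappa_less_square_root) (simp_all add: divide_simps)
  then have "337601881156089608898371150975274103674007083620088526227 / 10 ^ 55 > kappa ^ 2 ^ 4"
    by (rule kappa_less_square_root) (simp_all add: divide_simps)
  then have "581035180652677526748365905359560338332955666448373373718 / 10 ^ 56 > kappa ^ 2 ^ 3"
    by (rule kappa_less_square_root) (simp_all add: divide_simps)
  then have "241046713450459126302052428458436626520043268314519884489 / 10 ^ 56 > kappa ^ 2 ^ 2"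
    by (rule kappa_less_square_root) (simp_all add: divide_simps)
  then have "155256791622930018056870167597084592579722541291327604288 / 10 ^ 56 > kappa ^ 2 ^ 1"
    by (rule kappa_less_square_root) (simp_all add: divide_simps)
  then have "12460208329836625089431529441999359284665241772983812582 / 10 ^ 55 > kappa ^ 2 ^ 0"
    by (rule kappa_less_square_root) (simp_all add: divide_simps)
  then show ?thesis by simp
qed

text \<open>Summability is included because an infinite sum in HOL denotes a limit only for a
  summable series. The floor of \<open>kappa * 10 ^ 55\<close> expresses the leading digit and the
  55 decimals.\<close>

theorem mainTheorem4:
  shows "summable kappa_term \<and>
    (\<forall>h\<ge>2. int (num_leaf_induced (complete_binary_tree h)) = \<lfloor>2 * kappa ^ (2 ^ h)\<rfloor>) \<and>
    \<lfloor>kappa * 10 ^ 55\<rfloor> = 12460208329836625089431529441999359284665241772983812581"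
proof (intro conjI allI impI)
  show "\<lfloor>kappa * 10 ^ 55\<rfloor> = 12460208329836625089431529441999359284665241772983812581"
    using kappa_ge_55_digits kappa_less_55_digits by (intro floor_unique) (simp_all add: field_simps)
qed (auto intro: summable_kappa_term floor_two_kappa_power)

end
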